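(* Let $X$ be a visual Gromov hyperbolic space whose boundary at infinity $\partial_\infty X$, taken with a visual metric, has finite capacity dimension, $\operatorname{cdim}(\partial_\infty X)<\infty$. Then there exist metric trees $T_1,\dots,T_n$, with $n=\operatorname{cdim}(\partial_\infty X)+1$, and a quasi-isometric embedding $f:X\to T_1\times\dots\times T_n$.
   Context: A map $f:X\to Y$ between metric spaces is a quasi-isometric embedding if there are $\Lambda\ge1$, $\sigma\ge0$ with $\frac1\Lambda|xx'|-\sigma\le|f(x)f(x')|\le\Lambda|xx'|+\sigma$ for all $x,x'\in X$. A metric tree is a geodesic metric space which is a real tree. Products of metric spaces carry the $\ell^2$ product metric. Gromov product: $(x|x')_o=\frac12(|xo|+|x'o|-|xx'|)$. A metric space $X$ is (Gromov) hyperbolic if for some $\delta\ge0$ and base point $o$, $(x|x'')_o\ge\min\{(x|x')_o,(x'|x'')_o\}-\delta$ for all $x,x',x''$. A sequence $(x_i)$ converges to infinity if $(x_i|x_j)_o\to\infty$ as $i,j\to\infty$; two such sequences are equivalent if $(x_i|x_i')_o\to\infty$; $\partial_\infty X$ is the set of equivalence classes. For $\xi,\xi'\in\partial_\infty X$, $(\xi|\xi')_o=\inf\liminf_i(x_i|x_i')_o$ over representatives; for $x\in X$, $(x|\xi)_o=\inf\liminf_i(x|x_i)_o$ over representatives $(x_i)\in\xi$. A metric $d$ on $\partial_\infty X$ is visual if there are $o\in X$, $a>1$, $c_1,c_2>0$ with $c_1a^{-(\xi|\xi')_o}\le d(\xi,\xi')\le c_2a^{-(\xi|\xi')_o}$ for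 all $\xi,\xi'$. $X$ is visual if for some $x_0\in X$ there is $D>0$ such that for every $x\in X$ there is $\xi\in\partial_\infty X$ with $|xx_0|\le(x|\xi)_{x_0}+D$. Capacity dimension: For a family $\mathcal U$ of subsets of a metric space $Z$, $\operatorname{mesh}(\mathcal U)=\sup_{U\in\mathcal U}\operatorname{diam}U$. A family is disjoint if its members are pairwise disjoint; a covering $\mathcal U$ of $Z$ is $(m+1)$-colored if $\mathcal U=\bigcup_{a\in A}\mathcal U^a$ with $|A|=m+1$ and each $\mathcal U^a$ disjoint. For an open covering $\mathcal U$ and $z\in Z$, $L(\mathcal U,z)=\min\{\sup_{U\in\mathcal U}\operatorname{dist}(z,Z\setminus U),\operatorname{mesh}(\mathcal U)\}$ (with $\operatorname{dist}(z,\emptyset)=\infty$) and the Lebesgue number is $L(\mathcal U)=\inf_{z\in Z}L(\mathcal U,z)$. $\operatorname{cdim}(Z)$ is the least integer $m\ge0$ for which there is $\delta>0$ such that for every sufficiently small $\tau>0$ there is an open $(m+1)$-colored covering $\mathcal U$ of $Z$ with $\operatorname{mesh}(\mathcal U)\le\tau$ and $L(\mathcal U)\ge\delta\tau$ (it is $\infty$ if no such $m$ exists). *)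

theory Defs
  imports "HOL-Analysis.Analysis"
begin

definition metric_on :: "'b set \<Rightarrow> ('b \<Rightarrow> 'b \<Rightarrow> real) \<Rightarrow> bool" where
  "metric_on S d \<longleftrightarrow>
     (\<forall>x\<in>S. \<forall>y\<in>S. 0 \<le> d x y \<and> d x y = d y x \<and> (d x y = 0 \<longleftrightarrow> x = y)) \<and>
     (\<forall>x\<in>S. \<forall>y\<in>S. \<forall>z\<in>S. d x z \<le> d x y + d y z)"

definition gromov_prod :: "'a::metric_space \<Rightarrow> 'a \<Rightarrow> 'a \<Rightarrow> real" where
  "gromov_prod o' x y = (dist x o' + dist y o' - dist x y) / 2"

definition gromov_hyperbolic :: "'a::metric_space itself \<Rightarrow> bool" where
  "gromov_hyperbolic _ \<longleftrightarrow> (\<exists>\<delta>::real. \<delta> \<ge> 0 \<and> (\<exists>o'::'a. \<forall>x y z.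
      gromov_prod o' x z \<ge> min (gromov_prod o' x y) (gromov_prod o' y z) - \<delta>))"

text \<open>Convergence to infinity, w.r.t. base point o' (independent of o').\<close>
definition conv_inf :: "'a::metric_space \<Rightarrow> (nat \<Rightarrow> 'a) \<Rightarrow> bool" where
  "conv_inf o' x \<longleftrightarrow> (\<forall>M. \<exists>N. \<forall>i\<ge>N. \<forall>j\<ge>N. gromov_prod o' (x i) (x j) \<ge> M)"

definition seq_equiv :: "'a::metric_space \<Rightarrow> (nat \<Rightarrow> 'a) \<Rightarrow> (nat \<Rightarrow> 'a) \<Rightarrow> bool" where
  "seq_equiv o' x y \<longleftrightarrow> (\<forall>M. \<exists>N. \<forall>i\<ge>N. gromov_prod o' (x i) (y i) \<ge> M)"

definition bdry :: "'a::metric_space \<Rightarrow> (nat \<Rightarrow> 'a) set set" where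
  "bdry o' = {{y. conv_inf o' y \<and> seq_equiv o' x y} | x. conv_inf o' x}"

definition gromov_prod_bdry :: "'a::metric_space \<Rightarrow> (nat \<Rightarrow> 'a) set \<Rightarrow> (nat \<Rightarrow> 'a) set \<Rightarrow> ereal" where
  "gromov_prod_bdry o' \<xi> \<eta> =
     Inf {liminf (\<lambda>i. ereal (gromov_prod o' (x i) (y i))) | x y. x \<in> \<xi> \<and> y \<in> \<eta>}"

definition gromov_prod_pt_bdry :: "'a::metric_space \<Rightarrow> 'a \<Rightarrow> (nat \<Rightarrow> 'a) set \<Rightarrow> ereal" where
  "gromov_prod_pt_bdry o' z \<xi> =
     Inf {liminf (\<lambda>i. ereal (gromov_prod o' z (x i))) | x. x \<in> \<xi>}"

definition exp_neg :: "real \<Rightarrow> ereal \<Rightarrow> real" where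
  "exp_neg a t = (if t = \<infinity> then 0 else a powr (- real_of_ereal t))"

definition visual_metric :: "'a::metric_space \<Rightarrow> ((nat \<Rightarrow> 'a) set \<Rightarrow> (nat \<Rightarrow> 'a) set \<Rightarrow> real) \<Rightarrow> bool" where
  "visual_metric b d \<longleftrightarrow> metric_on (bdry b) d \<and>
     (\<exists>o'::'a. \<exists>a>1. \<exists>c1>0. \<exists>c2>0. \<forall>\<xi>\<in>bdry b. \<forall>\<eta>\<in>bdry b.
        c1 * exp_neg a (gromov_prod_bdry o' \<xi> \<eta>) \<le> d \<xi> \<eta> \<and>
        d \<xi> \<eta> \<le> c2 * exp_neg a (gromov_prod_bdry o' \<xi> \<eta>))"

definition visual_space :: "'a::metric_space \<Rightarrow> bool" where
  "visual_space b \<longleftrightarrow> (\<exists>x0::'a. \<exists>D>0. \<forall>x. \<exists>\<xi>\<in>bdry b.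
      ereal (dist x x0) \<le> gromov_prod_pt_bdry x0 x \<xi> + ereal D)"

definition diam_on :: "('b \<Rightarrow> 'b \<Rightarrow> real) \<Rightarrow> 'b set \<Rightarrow> ereal" where
  "diam_on d U = Sup ({ereal (d x y) | x y. x \<in> U \<and> y \<in> U} \<union> {0})"

definition mesh :: "('b \<Rightarrow> 'b \<Rightarrow> real) \<Rightarrow> 'b set set \<Rightarrow> ereal" where
  "mesh d \<U> = (SUP U\<in>\<U>. diam_on d U)"

text \<open>dist(z, A) with dist(z, empty) = \<infinity>.\<close>
definition setdist_on :: "('b \<Rightarrow> 'b \<Rightarrow> real) \<Rightarrow> 'b \<Rightarrow> 'b set \<Rightarrow> ereal" where
  "setdist_on d z A = (INF w\<in>A. ereal (d z w))"

definition open_covering :: "'b set \<Rightarrow> ('b \<Rightarrow> 'b \<Rightarrow> real) \<Rightarrow> 'b set set \<Rightarrow> bool" where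
  "open_covering Z d \<U> \<longleftrightarrow> \<Union>\<U> = Z \<and>
     (\<forall>U\<in>\<U>. U \<subseteq> Z \<and> (\<forall>z\<in>U. \<exists>r>0. \<forall>w\<in>Z. d z w < r \<longrightarrow> w \<in> U))"

definition colored :: "nat \<Rightarrow> 'b set set \<Rightarrow> bool" where
  "colored k \<U> \<longleftrightarrow> (\<exists>\<V> :: nat \<Rightarrow> 'b set set.
      \<U> = (\<Union>a<k. \<V> a) \<and> (\<forall>a<k. disjoint (\<V> a)))"

definition lebesgue_at :: "'b set \<Rightarrow> ('b \<Rightarrow> 'b \<Rightarrow> real) \<Rightarrow> 'b set set \<Rightarrow> 'b \<Rightarrow> ereal" where
  "lebesgue_at Z d \<U> z = min (SUP U\<in>\<U>. setdist_on d z (Z - U)) (mesh d \<U>)"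

definition lebesgue_num :: "'b set \<Rightarrow> ('b \<Rightarrow> 'b \<Rightarrow> real) \<Rightarrow> 'b set set \<Rightarrow> ereal" where
  "lebesgue_num Z d \<U> = (INF z\<in>Z. lebesgue_at Z d \<U> z)"

definition cdim_le :: "'b set \<Rightarrow> ('b \<Rightarrow> 'b \<Rightarrow> real) \<Rightarrow> nat \<Rightarrow> bool" where
  "cdim_le Z d m \<longleftrightarrow> (\<exists>\<delta>>0. \<exists>\<tau>0>0. \<forall>\<tau>. 0 < \<tau> \<and> \<tau> \<le> \<tau>0 \<longrightarrow>
      (\<exists>\<U>. open_covering Z d \<U> \<and> colored (m + 1) \<U> \<and>
            mesh d \<U> \<le> ereal \<tau> \<and> lebesgue_num Z d \<U> \<ge> ereal (\<delta> * \<tau>)))"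

definition cdim :: "'b set \<Rightarrow> ('b \<Rightarrow> 'b \<Rightarrow> real) \<Rightarrow> enat" where
  "cdim Z d = (if \<exists>m. cdim_le Z d m then enat (LEAST m. cdim_le Z d m) else \<infinity>)"

definition geodesic_segments :: "'b set \<Rightarrow> ('b \<Rightarrow> 'b \<Rightarrow> real) \<Rightarrow> 'b \<Rightarrow> 'b \<Rightarrow> 'b set set" where
  "geodesic_segments T d x y = {\<gamma> ` {0..d x y} | \<gamma>. \<gamma> 0 = x \<and> \<gamma> (d x y) = y \<and>
      (\<forall>s\<in>{0..d x y}. \<gamma> s \<in> T) \<and>
      (\<forall>s\<in>{0..d x y}. \<forall>t\<in>{0..d x y}. d (\<gamma> s) (\<gamma> t) = \<bar>s - t\<bar>)}"

text \<open>Real tree (Bridson--Haefliger): unique geodesic segments, and concatenation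
  of segments meeting only at a common endpoint is a segment. Geodesic by (1).\<close>
definition metric_tree :: "'b set \<Rightarrow> ('b \<Rightarrow> 'b \<Rightarrow> real) \<Rightarrow> bool" where
  "metric_tree T d \<longleftrightarrow> metric_on T d \<and>
     (\<forall>x\<in>T. \<forall>y\<in>T. \<exists>!S. S \<in> geodesic_segments T d x y) \<and>
     (\<forall>x\<in>T. \<forall>y\<in>T. \<forall>z\<in>T. \<forall>S1\<in>geodesic_segments T d y x. \<forall>S2\<in>geodesic_segments T d x z.
        S1 \<inter> S2 = {x} \<longrightarrow> S1 \<union> S2 \<in> geodesic_segments T d y z)"

definition prod_dist :: "nat \<Rightarrow> (nat \<Rightarrow> 'b \<Rightarrow> 'b \<Rightarrow> real) \<Rightarrow> (nat \<Rightarrow> 'b) \<Rightarrow> (nat \<Rightarrow> 'b) \<Rightarrow> real" where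
  "prod_dist n dT p q = sqrt (\<Sum>i<n. (dT i (p i) (q i))\<^sup>2)"

definition qi_embedding :: "('a \<Rightarrow> 'a \<Rightarrow> real) \<Rightarrow> ('c \<Rightarrow> 'c \<Rightarrow> real) \<Rightarrow> ('a \<Rightarrow> 'c) \<Rightarrow> bool" where
  "qi_embedding dX dY f \<longleftrightarrow> (\<exists>\<Lambda>\<ge>1. \<exists>\<sigma>\<ge>0. \<forall>x x'.
     dX x x' / \<Lambda> - \<sigma> \<le> dY (f x) (f x') \<and> dY (f x) (f x') \<le> \<Lambda> * dX x x' + \<sigma>)"

end

theory Submission
  imports Defs
begin

text \<open>Visuality assigns to each \<open>x\<close> a boundary point \<open>\<xi> x\<close> such that, up to additive constants, the
  Gromov product of \<open>x\<close> and \<open>y\<close> at the base point \<open>p\<close> is the minimum of \<open>dist x p\<close>, \<open>dist y p\<close> and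
  \<open>- log a (d (\<xi> x) (\<xi> y))\<close>. The capacity dimension provides colored coverings of the boundary at
  all scales \<open>\<tau> k\<close>, decreasing geometrically. Within each color they are made laminar with a
  margin: a set of level \<open>k\<close> that meets a set of a finer level \<open>l\<close> contains a neighbourhood of it of
  radius proportional to \<open>\<tau> l\<close>. The sets of one color containing \<open>\<xi> x\<close>, of levels up to
  \<open>dist x p\<close> in suitable units, are then the vertices on a branch of a rooted tree ending at the
  image of \<open>x\<close>. The distance of the images of \<open>x\<close> and \<open>y\<close> in that tree is the size of a symmetric
  difference. By the margin, at most one set is lost before the branching level, which gives the
  upper bound; by the covering property each level beyond it is seen by some color, which gives
  the lower bound.\<close>

section \<open>Real trees from the four-point condition\<close>

lemma metric_on_nonneg: "metric_on S d \<Longrightarrow> x \<in> S \<Longrightarrow> y \<in> S \<Longrightarrow> 0 \<le> d x y"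
  and metric_on_commute: "metric_on S d \<Longrightarrow> x \<in> S \<Longrightarrow> y \<in> S \<Longrightarrow> d x y = d y x"
  and metric_on_eq_0_iff: "metric_on S d \<Longrightarrow> x \<in> S \<Longrightarrow> y \<in> S \<Longrightarrow> d x y = 0 \<longleftrightarrow> x = y"
  and metric_on_triangle:
    "metric_on S d \<Longrightarrow> x \<in> S \<Longrightarrow> y \<in> S \<Longrightarrow> z \<in> S \<Longrightarrow> d x z \<le> d x y + d y z"
  unfolding metric_on_def by blast+

locale four_point_metric =
  fixes T :: "'b set" and d :: "'b \<Rightarrow> 'b \<Rightarrow> real"
  assumes metric: "metric_on T d"
    and four_point: "\<lbrakk>p \<in> T; q \<in> T; r \<in> T; s \<in> T\<rbrakk> \<Longrightarrow>
      d p q + d r s \<le> max (d p r + d q s) (d p s + d q r)"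
begin

lemmas nonneg = metric_on_nonneg[OF metric]
  and commute = metric_on_commute[OF metric]
  and eq_0_iff = metric_on_eq_0_iff[OF metric]
  and triangle = metric_on_triangle[OF metric]

definition interval :: "'b \<Rightarrow> 'b \<Rightarrow> 'b set" where
  "interval x y = {r \<in> T. d x r + d r y = d x y}"

lemma interval_commute:
  assumes "x \<in> T" "y \<in> T"
  shows "interval x y = interval y x"
proof -
  have "d x r + d r y = d x y \<longleftrightarrow> d y r + d r x = d y x" if "r \<in> T" for r
    using commute[of x r] commute[of y r] commute[of x y] assms that by auto
  then show ?thesis unfolding interval_def by blast
qed

lemma interval_point_unique:
  assumes xy: "x \<in> T" "y \<in> T"
    and r: "r \<in> interval x y" and r': "r' \<in> interval x y" and eq: "d x r = d x r'"
  shows "r = r'"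
proof -
  have T: "r \<in> T" "r' \<in> T" and sums: "d x r + d r y = d x y" "d x r' + d r' y = d x y"
    using r r' unfolding interval_def by auto
  have "d x y + d r r' \<le> max (d x r + d y r') (d x r' + d y r)"
    by (rule four_point[OF xy T])
  then have "d r r' \<le> 0"
    using sums eq commute[OF xy(2) T(1)] commute[OF xy(2) T(2)] by linarith
  then show ?thesis
    using nonneg[OF T] eq_0_iff[OF T] by simp
qed

lemma interval_subset:
  assumes xy: "x \<in> T" "y \<in> T" and w: "w \<in> interval x y"
  shows "interval x w \<subseteq> interval x y"
proof
  fix r assume "r \<in> interval x w"
  then have r: "r \<in> T" "d x r + d r w = d x w" unfolding interval_def by auto
  have wT: "w \<in> T" "d x w + d w y = d x y" using w unfolding interval_def by auto
  have "d x r + d r y = d x y"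
    using triangle[OF xy(1) r(1) xy(2)] triangle[OF r(1) wT(1) xy(2)] r(2) wT(2) by linarith
  then show "r \<in> interval x y" using r unfolding interval_def by simp
qed

lemma geodesic_segment_eq_interval:
  assumes xy: "x \<in> T" "y \<in> T" and S: "S \<in> geodesic_segments T d x y"
  shows "S = interval x y"
proof -
  obtain \<gamma> where \<gamma>: "S = \<gamma> ` {0..d x y}" "\<gamma> 0 = x" "\<gamma> (d x y) = y"
    "\<And>s. s \<in> {0..d x y} \<Longrightarrow> \<gamma> s \<in> T"
    "\<And>s t. s \<in> {0..d x y} \<Longrightarrow> t \<in> {0..d x y} \<Longrightarrow> d (\<gamma> s) (\<gamma> t) = \<bar>s - t\<bar>"
    using S unfolding geodesic_segments_def by blast
  have ends: "d x (\<gamma> s) = s" "d (\<gamma> s) y = d x y - s" if "s \<in> {0..d x y}" for s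
    using \<gamma>(5)[of 0 s] \<gamma>(5)[of s "d x y"] that \<gamma>(2,3) nonneg[OF xy] by auto
  then have path: "\<gamma> s \<in> interval x y" if "s \<in> {0..d x y}" for s
    using that \<gamma>(4) unfolding interval_def by simp
  show ?thesis
  proof (intro equalityI subsetI)
    fix r assume "r \<in> S"
    then show "r \<in> interval x y" using \<gamma>(1) path by blast
  next
    fix r assume r: "r \<in> interval x y"
    then have s: "d x r \<in> {0..d x y}"
      using nonneg[of x r] nonneg[of r y] xy unfolding interval_def by auto
    have "r = \<gamma> (d x r)"
      using interval_point_unique[OF xy r path[OF s]] ends(1)[OF s] by simp
    then show "r \<in> S" using s \<gamma>(1) by blast
  qed
qed

end

locale geodesic_four_point_metric = four_point_metric +
  assumes geodesic: "x \<in> T \<Longrightarrow> y \<in> T \<Longrightarrow> geodesic_segments T d x y \<noteq> {}"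
begin

lemma geodesic_segments_eq_interval:
  "x \<in> T \<Longrightarrow> y \<in> T \<Longrightarrow> geodesic_segments T d x y = {interval x y}"
  using geodesic geodesic_segment_eq_interval by blast

lemma interval_point_exists:
  assumes "x \<in> T" "y \<in> T" "0 \<le> s" "s \<le> d x y"
  obtains r where "r \<in> interval x y" "d x r = s"
proof -
  have "interval x y \<in> geodesic_segments T d x y"
    using geodesic_segments_eq_interval[OF assms(1,2)] by simp
  then obtain \<gamma> where \<gamma>: "interval x y = \<gamma> ` {0..d x y}" "\<gamma> 0 = x"
    "\<And>s t. s \<in> {0..d x y} \<Longrightarrow> t \<in> {0..d x y} \<Longrightarrow> d (\<gamma> s) (\<gamma> t) = \<bar>s - t\<bar>"
    unfolding geodesic_segments_def by blast
  show ?thesis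
    using that[of "\<gamma> s"] \<gamma>(1,2) \<gamma>(3)[of 0 s] assms(3,4) by auto
qed

lemma interval_initial:
  assumes xy: "x \<in> T" "y \<in> T" and w: "w \<in> interval x y" and r: "r \<in> interval x y"
    and le: "d x r \<le> d x w"
  shows "r \<in> interval x w"
proof -
  have "w \<in> T" "r \<in> T" using w r unfolding interval_def by auto
  then obtain u where u: "u \<in> interval x w" "d x u = d x r"
    using interval_point_exists xy(1) nonneg le by metis
  then have "u \<in> interval x y"
    using interval_subset[OF xy w] by blast
  then have "r = u"
    using interval_point_unique[OF xy r] u(2) by simp
  then show ?thesis using u(1) by simp
qed

lemma interval_split:
  assumes xy: "x \<in> T" "y \<in> T" and w: "w \<in> interval x y"
  shows "interval x y = interval x w \<union> interval w y"
proof
  have wT: "w \<in> T" using w unfolding interval_def by simp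
  have swap: "interval y x = interval x y" "interval y w = interval w y"
    using interval_commute xy wT by auto
  show "interval x w \<union> interval w y \<subseteq> interval x y"
    using interval_subset[OF xy w] interval_subset[of y x w] xy w swap by auto
  show "interval x y \<subseteq> interval x w \<union> interval w y"
  proof
    fix r assume r: "r \<in> interval x y"
    have "r \<in> T" "d x r + d r y = d x w + d w y"
      using r w unfolding interval_def by auto
    then have "d x r \<le> d x w \<or> d y r \<le> d y w"
      using commute[of y] xy(2) wT by fastforce
    then show "r \<in> interval x w \<union> interval w y"
      using interval_initial[OF xy w r] interval_initial[of y x w r] xy w r swap by auto
  qed
qed

lemma branch_point_exists:
  assumes T: "x \<in> T" "y \<in> T" "z \<in> T"
  obtains w where "w \<in> interval x y" "w \<in> interval x z" "d x w = (d x y + d x z - d y z) / 2"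
proof -
  define \<mu> where "\<mu> = (d x y + d x z - d y z) / 2"
  have "0 \<le> \<mu>" "\<mu> \<le> d x y"
    using triangle[of y x z] triangle[of x y z] commute[of x y] T unfolding \<mu>_def by auto
  then obtain w where w: "w \<in> interval x y" "d x w = \<mu>"
    using interval_point_exists T by metis
  have wT: "w \<in> T" "d x w + d w y = d x y"
    using w unfolding interval_def by auto
  have "d w z = d x z - \<mu>"
  proof (rule antisym)
    have "d w z + d x y \<le> max (d w x + d z y) (d w y + d z x)"
      using four_point T wT by blast
    then show "d w z \<le> d x z - \<mu>"
      using wT w(2) commute[of w x] commute[of z y] commute[of z x] T
      unfolding \<mu>_def by (simp add: field_simps)
    show "d x z - \<mu> \<le> d w z"
      using triangle[of x w z] T wT(1) w(2) by simp
  qed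
  then have "w \<in> interval x z"
    using w(2) wT(1) unfolding interval_def by simp
  then show ?thesis
    using that w unfolding \<mu>_def by blast
qed

lemma interval_join:
  assumes T: "x \<in> T" "y \<in> T" "z \<in> T" and meet: "interval y x \<inter> interval x z = {x}"
  shows "interval y x \<union> interval x z = interval y z"
proof -
  obtain w where w: "w \<in> interval x y" "w \<in> interval x z" "d x w = (d x y + d x z - d y z) / 2"
    using branch_point_exists[OF T] .
  then have "w = x"
    using meet interval_commute T by blast
  then have "x \<in> interval y z"
    using w(3) eq_0_iff[of x x] commute[of x y] T unfolding interval_def by simp
  then show ?thesis
    using interval_split T by blast
qed

lemma metric_tree: "metric_tree T d"
  unfolding metric_tree_def
proof (intro conjI ballI impI)
  show "metric_on T d" by (rule metric)
next
  fix x y assume "x \<in> T" "y \<in> T"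
  then show "\<exists>!S. S \<in> geodesic_segments T d x y"
    using geodesic_segments_eq_interval by simp
next
  fix x y z S1 S2
  assume "x \<in> T" "y \<in> T" "z \<in> T" "S1 \<in> geodesic_segments T d y x"
    "S2 \<in> geodesic_segments T d x z" "S1 \<inter> S2 = {x}"
  then show "S1 \<union> S2 \<in> geodesic_segments T d y z"
    using geodesic_segments_eq_interval interval_join by simp
qed

end

section \<open>Trees from ultrametric products\<close>

locale pseudometric =
  fixes d :: "'b \<Rightarrow> 'b \<Rightarrow> real"
  assumes self [simp]: "d x x = 0"
    and commute: "d x y = d y x"
    and triangle: "d x z \<le> d x y + d y z"
begin

lemma nonneg: "0 \<le> d x y"
  using triangle[of x x y] commute[of x y] by simp

definition rep :: "'b \<Rightarrow> 'b" where
  "rep x = (SOME y. d x y = 0)"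

lemma dist_rep: "d x (rep x) = 0"
  unfolding rep_def by (rule someI[of _ x]) simp

lemma dist_rep_rep [simp]: "d (rep x) (rep y) = d x y"
  using triangle[of "rep x" "rep y" x] triangle[of x "rep y" y] triangle[of x y "rep x"]
    triangle[of "rep x" y "rep y"] dist_rep[of x] dist_rep[of y] commute[of x "rep x"]
    commute[of y "rep y"]
  by linarith

lemma rep_eq_iff: "rep x = rep y \<longleftrightarrow> d x y = 0"
proof
  assume "rep x = rep y"
  then show "d x y = 0" using dist_rep_rep[of x y] by simp
next
  assume "d x y = 0"
  then have "d x r = 0 \<longleftrightarrow> d y r = 0" for r
    using triangle[of x r y] triangle[of y r x] commute[of x y] nonneg[of x r] nonneg[of y r]
    by linarith
  then show "rep x = rep y" unfolding rep_def by simp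
qed

lemma metric_on_range_rep: "metric_on (range rep) d"
  unfolding metric_on_def by (auto simp: nonneg rep_eq_iff intro: commute triangle)

lemma geodesic_segments_range_rep:
  assumes ends: "d (\<gamma> 0) x = 0" "d (\<gamma> (d x y)) y = 0"
    and iso: "\<And>s t. \<lbrakk>0 \<le> s; s \<le> t; t \<le> d x y\<rbrakk> \<Longrightarrow> d (\<gamma> s) (\<gamma> t) = t - s"
  shows "geodesic_segments (range rep) d (rep x) (rep y) \<noteq> {}"
proof -
  have "d (\<gamma> s) (\<gamma> t) = \<bar>s - t\<bar>" if "s \<in> {0..d x y}" "t \<in> {0..d x y}" for s t
    using iso[of s t] iso[of t s] commute[of "\<gamma> s" "\<gamma> t"] that by (cases "s \<le> t") auto
  then have "(rep \<circ> \<gamma>) ` {0..d x y} \<in> geodesic_segments (range rep) d (rep x) (rep y)"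
    unfolding geodesic_segments_def using ends rep_eq_iff
    by (intro CollectI exI[of _ "rep \<circ> \<gamma>"]) auto
  then show ?thesis by blast
qed

end

definition tree_dist :: "('b \<Rightarrow> 'b \<Rightarrow> real) \<Rightarrow> 'b \<Rightarrow> 'b \<Rightarrow> real" where
  "tree_dist g x y = g x x + g y y - 2 * g x y"

locale ultrametric_product =
  fixes g :: "'b \<Rightarrow> 'b \<Rightarrow> real"
  assumes commute: "g x y = g y x"
    and nonneg: "0 \<le> g x y"
    and ultra: "min (g x y) (g y z) \<le> g x z"
begin

lemma le_self: "g x y \<le> g x x" "g x y \<le> g y y"
  using ultra[of x y x] ultra[of y x y] commute[of x y] by simp_all

sublocale tree: pseudometric "tree_dist g"
proof
  fix x y z
  show "tree_dist g x x = 0" "tree_dist g x y = tree_dist g y x"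
    unfolding tree_dist_def using commute[of x y] by simp_all
  show "tree_dist g x z \<le> tree_dist g x y + tree_dist g y z"
    unfolding tree_dist_def using ultra[of x y z] le_self(2)[of x y] le_self(1)[of y z]
    by linarith
qed

lemma four_point:
  "tree_dist g p q + tree_dist g r s
     \<le> max (tree_dist g p r + tree_dist g q s) (tree_dist g p s + tree_dist g q r)"
proof (rule ccontr)
  assume "\<not> ?thesis"
  then have "g p q + g r s < g p r + g q s" "g p q + g r s < g p s + g q r"
    unfolding tree_dist_def by auto
  moreover have "g p r \<le> g p q \<or> g q r \<le> g p q" "g p s \<le> g p q \<or> g q s \<le> g p q"
    "g p r \<le> g r s \<or> g p s \<le> g r s" "g q r \<le> g r s \<or> g q s \<le> g r s"
    using ultra[of p r q] ultra[of p s q] ultra[of r p s] ultra[of r q s]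
    unfolding commute[of r q] commute[of s q] commute[of r p] by (simp_all add: min_le_iff_disj)
  ultimately show False
    by (elim disjE) linarith+
qed

text \<open>A pair \<open>(x, t)\<close> stands for the point at height \<open>t\<close>, clipped to the interval from \<open>0\<close> to
  \<open>g x x\<close>, on the branch from the root to \<open>x\<close>; the branches of \<open>x\<close> and \<open>y\<close> are glued up to height
  \<open>g x y\<close>. Choosing one pair in each glueing class keeps the tree inside \<open>'b \<times> real\<close>.\<close>
definition height :: "'b \<times> real \<Rightarrow> real" where
  "height p = max 0 (min (snd p) (g (fst p) (fst p)))"

definition meet :: "'b \<times> real \<Rightarrow> 'b \<times> real \<Rightarrow> real" where
  "meet p q = min (min (height p) (height q)) (g (fst p) (fst q))"

abbreviation glue_dist :: "'b \<times> real \<Rightarrow> 'b \<times> real \<Rightarrow> real" where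
  "glue_dist \<equiv> tree_dist meet"

lemma height_bounds: "0 \<le> height p" "height p \<le> g (fst p) (fst p)"
  unfolding height_def using nonneg by auto

lemma height_Pair [simp]: "0 \<le> t \<Longrightarrow> t \<le> g x x \<Longrightarrow> height (x, t) = t"
  unfolding height_def by simp

lemma meet_self [simp]: "meet p p = height p"
  unfolding meet_def using height_bounds[of p] by simp

lemma meet_bounds: "0 \<le> meet p q" "meet p q \<le> height p" "meet p q \<le> height q"
  unfolding meet_def using height_bounds[of p] height_bounds[of q] nonneg by auto

lemma ultrametric_product_meet: "ultrametric_product meet"
proof
  fix p q r
  show "meet p q = meet q p"
    unfolding meet_def using commute[of "fst p" "fst q"] by (simp add: min.commute)
  show "0 \<le> meet p q" by (rule meet_bounds)
  show "min (meet p q) (meet q r) \<le> meet p r"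
    unfolding meet_def using ultra[of "fst p" "fst q" "fst r"] by auto
qed

lemma meet_same_branch:
  "\<lbrakk>0 \<le> t; t \<le> g x x; 0 \<le> s; s \<le> g x x\<rbrakk> \<Longrightarrow> meet (x, t) (x, s) = min t s"
  unfolding meet_def by simp

lemma meet_above:
  assumes "meet p q \<le> t" "t \<le> height p" "meet p q \<le> s" "s \<le> height q"
  shows "meet (fst p, t) (fst q, s) = meet p q"
proof -
  have "0 \<le> t" "t \<le> g (fst p) (fst p)" "0 \<le> s" "s \<le> g (fst q) (fst q)"
    using assms meet_bounds[of p q] height_bounds[of p] height_bounds[of q] by linarith+
  then have "meet (fst p, t) (fst q, s) = min (min t s) (g (fst p) (fst q))"
    unfolding meet_def by simp
  then show ?thesis
    using assms unfolding meet_def by linarith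
qed

definition glue_path :: "'b \<times> real \<Rightarrow> 'b \<times> real \<Rightarrow> real \<Rightarrow> 'b \<times> real" where
  "glue_path p q u = (if u \<le> height p - meet p q then (fst p, height p - u)
     else (fst q, u - height p + 2 * meet p q))"

lemma glue_path_start: "glue_dist (glue_path p q 0) p = 0"
  using meet_bounds[of p q] height_bounds[of p]
  by (simp add: glue_path_def tree_dist_def meet_def)

lemma glue_path_end: "glue_dist (glue_path p q (glue_dist p q)) q = 0"
proof (cases "height q = meet p q")
  case True
  then have "glue_path p q (glue_dist p q) = (fst p, height q)"
    by (simp add: glue_path_def tree_dist_def)
  moreover have "meet (fst p, height q) q = height q" "height (fst p, height q) = height q"
    using True meet_bounds[of p q] height_bounds[of p] height_bounds[of q]
    unfolding meet_def by auto
  ultimately show ?thesis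
    unfolding tree_dist_def by simp
next
  case False
  then have "glue_path p q (glue_dist p q) = (fst q, height q)"
    using meet_bounds(3)[of p q] by (simp add: glue_path_def tree_dist_def)
  then show ?thesis
    using height_bounds[of q] by (simp add: tree_dist_def meet_def)
qed

lemma glue_path_isometric:
  assumes "0 \<le> u" "u \<le> v" "v \<le> glue_dist p q"
  shows "glue_dist (glue_path p q u) (glue_path p q v) = v - u"
proof -
  note bounds = meet_bounds[of p q] height_bounds[of p] height_bounds[of q]
  have v: "v - height p + 2 * meet p q \<le> height q"
    using assms(3) unfolding tree_dist_def by simp
  consider "v \<le> height p - meet p q" | "u \<le> height p - meet p q" "height p - meet p q < v"
    | "height p - meet p q < u"
    by linarith
  then show ?thesis
  proof cases
    case 1
    then show ?thesis
      using assms bounds meet_same_branch[of "height p - u" "fst p" "height p - v"]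
      by (simp add: glue_path_def tree_dist_def)
  next
    case 2
    then show ?thesis
      using assms bounds v meet_above[of p q "height p - u" "v - height p + 2 * meet p q"]
      by (simp add: glue_path_def tree_dist_def)
  next
    case 3
    then show ?thesis
      using assms bounds v
        meet_same_branch[of "u - height p + 2 * meet p q" "fst q" "v - height p + 2 * meet p q"]
      by (simp add: glue_path_def tree_dist_def)
  qed
qed

lemma tree_exists:
  "\<exists>(T :: ('b \<times> real) set) dT f. metric_tree T dT \<and> (\<forall>x. f x \<in> T) \<and>
     (\<forall>x y. dT (f x) (f y) = tree_dist g x y)"
proof -
  interpret glued: ultrametric_product meet by (rule ultrametric_product_meet)
  define f where "f x = glued.tree.rep (x, g x x)" for x
  have "metric_tree (range glued.tree.rep) glue_dist"
  proof (intro geodesic_four_point_metric.metric_tree geodesic_four_point_metric.intro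
      four_point_metric.intro geodesic_four_point_metric_axioms.intro)
    show "metric_on (range glued.tree.rep) glue_dist"
      by (rule glued.tree.metric_on_range_rep)
  next
    fix p q assume "p \<in> range glued.tree.rep" "q \<in> range glued.tree.rep"
    then show "geodesic_segments (range glued.tree.rep) glue_dist p q \<noteq> {}"
      using glued.tree.geodesic_segments_range_rep
        [OF glue_path_start glue_path_end glue_path_isometric] by blast
  qed (rule glued.four_point)
  moreover have "glue_dist (f x) (f y) = tree_dist g x y" for x y
  proof -
    have "glue_dist (f x) (f y) = glue_dist (x, g x x) (y, g y y)"
      unfolding f_def by (rule glued.tree.dist_rep_rep)
    also have "\<dots> = tree_dist g x y"
      using nonneg le_self[of x y] by (simp add: tree_dist_def meet_def)
    finally show ?thesis .
  qed
  ultimately show ?thesis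
    by (intro exI[of _ "range glued.tree.rep"] exI[of _ glue_dist] exI[of _ f])
      (simp add: f_def)
qed

end

lemma tree_of_nested_sets:
  fixes S :: "'a \<Rightarrow> 'c set"
  assumes fin: "\<And>x. finite (S x)"
    and nested: "\<And>x y z. S x \<inter> S y \<subseteq> S z \<or> S y \<inter> S z \<subseteq> S x"
  shows "\<exists>(T :: ('a \<times> real) set) dT f. metric_tree T dT \<and> (\<forall>x. f x \<in> T) \<and>
           (\<forall>x y. dT (f x) (f y) = real (card (S x - S y)) + real (card (S y - S x)))"
proof -
  define g where "g x y = real (card (S x \<inter> S y))" for x y
  interpret ultrametric_product g
  proof
    fix x y z
    show "g x y = g y x" "0 \<le> g x y"
      unfolding g_def by (simp_all add: Int_commute)
    have "S x \<inter> S y \<subseteq> S x \<inter> S z \<or> S y \<inter> S z \<subseteq> S x \<inter> S z"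
      using nested[of x y z] by blast
    then have "g x y \<le> g x z \<or> g y z \<le> g x z"
      unfolding g_def using fin card_mono[of "S x \<inter> S z"] by auto
    then show "min (g x y) (g y z) \<le> g x z" by auto
  qed
  have "tree_dist g x y = real (card (S x - S y)) + real (card (S y - S x))" for x y
    using fin card_Int_Diff[of "S x" "S y"] card_Int_Diff[of "S y" "S x"]
    unfolding tree_dist_def g_def by (simp add: Int_commute)
  then show ?thesis
    using tree_exists by simp
qed

section \<open>Laminar families from colored coverings\<close>

lemma card_nat_le_interval:
  fixes \<alpha> \<beta> :: real
  assumes "finite K" "\<And>k. k \<in> K \<Longrightarrow> \<alpha> \<le> real k" "\<And>k. k \<in> K \<Longrightarrow> real k \<le> \<beta>" "\<alpha> \<le> \<beta>"
  shows "real (card K) \<le> \<beta> - \<alpha> + 1"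
proof (cases "K = {}")
  case False
  have "K \<subseteq> {Min K..Max K}"
    using assms(1) by auto
  then have "card K \<le> Suc (Max K) - Min K"
    using card_mono[of "{Min K..Max K}" K] by simp
  moreover have "Min K \<le> Max K" "\<alpha> \<le> real (Min K)" "real (Max K) \<le> \<beta>"
    using assms(1-3) False by simp_all
  ultimately show ?thesis by linarith
qed (use assms(4) in auto)

text \<open>\<open>N k\<close> is one color class of a covering at scale \<open>\<tau> k\<close>. Fattening its members slightly and
  saturating with respect to chains of fattened members of all finer levels makes the members of
  different levels either disjoint or nested with a margin, while moving points only by a small
  fraction of \<open>\<tau> k\<close>.\<close>
locale separated_families = pseudometric \<rho> for \<rho> :: "'a \<Rightarrow> 'a \<Rightarrow> real" +
  fixes N :: "nat \<Rightarrow> 'a set set" and \<tau> :: "nat \<Rightarrow> real" and \<eta> :: real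
  assumes \<eta>_pos: "0 < \<eta>" and \<eta>_le_1: "\<eta> \<le> 1"
    and \<tau>_pos: "0 < \<tau> k"
    and \<tau>_Suc: "\<tau> (Suc k) \<le> \<eta> / 16 * \<tau> k"
    and member_diam: "V \<in> N k \<Longrightarrow> v \<in> V \<Longrightarrow> w \<in> V \<Longrightarrow> \<rho> v w \<le> \<tau> k"
    and members_apart:
      "V \<in> N k \<Longrightarrow> W \<in> N k \<Longrightarrow> V \<noteq> W \<Longrightarrow> v \<in> V \<Longrightarrow> w \<in> W \<Longrightarrow> \<eta> * \<tau> k \<le> \<rho> v w"
begin

lemma margin_pos: "0 < \<eta> * \<tau> k"
  using \<eta>_pos \<tau>_pos by simp

lemma margin_le: "\<eta> * \<tau> k \<le> \<tau> k"
  using \<eta>_le_1 \<tau>_pos[of k] by simp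

definition fat :: "nat \<Rightarrow> 'a set \<Rightarrow> 'a set" where
  "fat k V = {x. \<exists>v\<in>V. \<rho> v x \<le> \<eta> * \<tau> k / 4}"

definition block :: "nat \<Rightarrow> 'a \<Rightarrow> 'a \<Rightarrow> bool" where
  "block k x y \<longleftrightarrow> (\<exists>V\<in>N k. x \<in> fat k V \<and> y \<in> fat k V)"

definition chain :: "nat \<Rightarrow> nat \<Rightarrow> 'a \<Rightarrow> 'a \<Rightarrow> bool" where
  "chain k K = (\<lambda>x y. \<exists>l. k \<le> l \<and> l < K \<and> block l x y)\<^sup>*\<^sup>*"

definition linked :: "nat \<Rightarrow> 'a \<Rightarrow> 'a \<Rightarrow> bool" where
  "linked k x y \<longleftrightarrow> (\<exists>K. chain k K x y)"

definition envelope :: "nat \<Rightarrow> 'a set \<Rightarrow> 'a set" where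
  "envelope k V = {z. \<exists>v\<in>V. linked (Suc k) v z}"

lemma fat_superset: "V \<subseteq> fat k V"
  unfolding fat_def using margin_pos[of k] by force

lemma fat_diam:
  assumes "V \<in> N k" "x \<in> fat k V" "y \<in> fat k V"
  shows "\<rho> x y \<le> \<tau> k + \<eta> * \<tau> k / 2"
proof -
  obtain v w where vw: "v \<in> V" "w \<in> V" "\<rho> v x \<le> \<eta> * \<tau> k / 4" "\<rho> w y \<le> \<eta> * \<tau> k / 4"
    using assms unfolding fat_def by blast
  then show ?thesis
    using member_diam[OF assms(1) vw(1,2)] triangle[of x y v] triangle[of v y w] commute[of x v]
    by linarith
qed

lemma fat_unique:
  assumes VW: "V \<in> N k" "W \<in> N k" and "x \<in> fat k V" "y \<in> fat k W"
    and close: "\<rho> x y < \<eta> * \<tau> k / 2"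
  shows "V = W"
proof (rule ccontr)
  assume "V \<noteq> W"
  obtain v w where vw: "v \<in> V" "w \<in> W" "\<rho> v x \<le> \<eta> * \<tau> k / 4" "\<rho> w y \<le> \<eta> * \<tau> k / 4"
    using assms(3,4) unfolding fat_def by blast
  then show False
    using members_apart[OF VW \<open>V \<noteq> W\<close> vw(1,2)] triangle[of v w x] triangle[of x w y]
      commute[of w y] close
    by linarith
qed

lemma chain_refl: "chain k K x x"
  unfolding chain_def by simp

lemma chain_trans: "chain k K x y \<Longrightarrow> chain k K y z \<Longrightarrow> chain k K x z"
  unfolding chain_def by (rule rtranclp_trans)

lemma chain_sym: "chain k K x y \<Longrightarrow> chain k K y x"
  unfolding chain_def
  by (rule sympD[OF symp_rtranclp]) (auto simp: symp_def block_def)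

lemma chain_mono:
  assumes "k' \<le> k" "K \<le> K'" "chain k K x y"
  shows "chain k' K' x y"
  using assms(3) unfolding chain_def
  by (rule rtranclp_mono[THEN predicate2D, rotated]) (use assms(1,2) in \<open>auto intro: order_trans\<close>)

lemma chain_step: "block l x y \<Longrightarrow> k \<le> l \<Longrightarrow> l < K \<Longrightarrow> chain k K x y"
  unfolding chain_def by blast

text \<open>Two members of level \<open>k\<close> lie too far apart to be joined by a chain of finer levels, so a chain
  visits at most one of them.\<close>
lemma chain_Suc_cases:
  assumes small: "\<forall>x y. chain (Suc k) K x y \<longrightarrow> \<rho> x y < \<eta> * \<tau> k / 2"
    and "chain k K x y"
  obtains (finer) "chain (Suc k) K x y"
    | (through) V p q where "V \<in> N k" "p \<in> fat k V" "q \<in> fat k V"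
      "chain (Suc k) K x p" "chain (Suc k) K q y"
proof -
  have "chain (Suc k) K x y \<or>
    (\<exists>V\<in>N k. \<exists>p\<in>fat k V. \<exists>q\<in>fat k V. chain (Suc k) K x p \<and> chain (Suc k) K q y)"
    using assms(2) unfolding chain_def[of k]
  proof (induction rule: rtranclp_induct)
    case base
    show ?case by (simp add: chain_refl)
  next
    case (step y z)
    then obtain l where l: "k \<le> l" "l < K" "block l y z" by blast
    show ?case
    proof (cases "l = k")
      case False
      then have "chain (Suc k) K y z"
        using l by (intro chain_step) auto
      then show ?thesis
        using step.IH chain_trans by meson
    next
      case True
      then obtain W where W: "W \<in> N k" "y \<in> fat k W" "z \<in> fat k W"
        using l(3) unfolding block_def by blast
      moreover have "V = W" if "V \<in> N k" "q \<in> fat k V" "chain (Suc k) K q y" for V q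
        using fat_unique that W(1,2) small by blast
      ultimately show ?thesis
        using step.IH chain_refl by metis
    qed
  qed
  then show ?thesis using finer through by blast
qed

lemma chain_bound:
  assumes "k \<le> K" "chain k K x y"
  shows "\<rho> x y \<le> 2 * \<tau> k"
  using assms
proof (induction k arbitrary: x y rule: inc_induct)
  case base
  then have "x = y"
    unfolding chain_def by (induction rule: rtranclp_induct) auto
  then show ?case using \<tau>_pos[of K] by simp
next
  case (step k)
  have \<tau>_Suc_le: "2 * \<tau> (Suc k) \<le> \<eta> * \<tau> k / 8"
    using \<tau>_Suc[of k] by simp
  have small: "\<forall>x y. chain (Suc k) K x y \<longrightarrow> \<rho> x y < \<eta> * \<tau> k / 2"
    using step.IH \<tau>_Suc_le margin_pos[of k] by fastforce
  from small step.prems show ?case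
  proof (cases rule: chain_Suc_cases)
    case finer
    then have "\<rho> x y < \<eta> * \<tau> k / 2"
      using small by blast
    then show ?thesis
      using margin_le[of k] \<tau>_pos[of k] by linarith
  next
    case (through V p q)
    show ?thesis
      using step.IH[OF through(4)] step.IH[OF through(5)] fat_diam[OF through(1-3)]
        triangle[of x y p] triangle[of p y q] \<tau>_Suc_le margin_le[of k] margin_pos[of k]
      by linarith
  qed
qed

lemma linked_bound:
  assumes "linked k x y"
  shows "\<rho> x y \<le> 2 * \<tau> k"
proof -
  obtain K where "chain k K x y" using assms unfolding linked_def by blast
  then have "chain k (max k K) x y" by (rule chain_mono[rotated 2]) auto
  then show ?thesis by (rule chain_bound[rotated]) simp
qed

lemma linked_trans:
  assumes "linked k x y" "linked k y z"
  shows "linked k x z"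
proof -
  obtain K L where "chain k K x y" "chain k L y z" using assms unfolding linked_def by blast
  then have "chain k (max K L) x y" "chain k (max K L) y z"
    by (auto intro: chain_mono[rotated 2])
  then show ?thesis
    unfolding linked_def using chain_trans by blast
qed

lemma linked_sym: "linked k x y \<Longrightarrow> linked k y x"
  unfolding linked_def using chain_sym by blast

lemma linked_antimono: "k \<le> l \<Longrightarrow> linked l x y \<Longrightarrow> linked k x y"
  unfolding linked_def using chain_mono by blast

lemma linked_fat: "V \<in> N k \<Longrightarrow> x \<in> fat k V \<Longrightarrow> y \<in> fat k V \<Longrightarrow> linked k x y"
  unfolding linked_def by (intro exI[of _ "Suc k"] chain_step[of k]) (auto simp: block_def)

lemma envelope_superset: "V \<subseteq> envelope k V"
  unfolding envelope_def linked_def using chain_refl by blast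

lemma envelope_diam:
  assumes "V \<in> N k" "x \<in> envelope k V" "y \<in> envelope k V"
  shows "\<rho> x y \<le> 2 * \<tau> k"
proof -
  obtain v w where v: "v \<in> V" "linked (Suc k) v x" and w: "w \<in> V" "linked (Suc k) w y"
    using assms unfolding envelope_def by blast
  show ?thesis
    using linked_bound[OF v(2)] linked_bound[OF w(2)] member_diam[OF assms(1) v(1) w(1)]
      \<tau>_Suc[of k] triangle[of x y v] triangle[of v y w] commute[of x v] margin_le[of k] \<tau>_pos[of k]
    by linarith
qed

lemma envelope_unique:
  assumes "V \<in> N k" "W \<in> N k" "x \<in> envelope k V" "x \<in> envelope k W"
  shows "V = W"
proof (rule ccontr)
  assume "V \<noteq> W"
  obtain v w where v: "v \<in> V" "linked (Suc k) v x" and w: "w \<in> W" "linked (Suc k) w x"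
    using assms unfolding envelope_def by blast
  show False
    using linked_bound[OF v(2)] linked_bound[OF w(2)] margin_pos[of k]
      members_apart[OF assms(1,2) \<open>V \<noteq> W\<close> v(1) w(1)] \<tau>_Suc[of k] triangle[of v w x]
      commute[of x w]
    by linarith
qed

lemma envelope_absorbs:
  assumes "k < l" and W: "W \<in> N l" and x: "x \<in> envelope k V" "x \<in> envelope l W"
    and y: "y \<in> envelope l W" and yz: "\<rho> y z \<le> \<eta> * \<tau> l / 8"
  shows "z \<in> envelope k V"
proof -
  obtain v w u where v: "v \<in> V" "linked (Suc k) v x" and w: "w \<in> W" "linked (Suc l) w x"
    and u: "u \<in> W" "linked (Suc l) u y"
    using x y unfolding envelope_def by blast
  have "\<rho> u z \<le> \<eta> * \<tau> l / 4"
    using triangle[of u z y] linked_bound[OF u(2)] yz \<tau>_Suc[of l] by linarith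
  then have "z \<in> fat l W"
    unfolding fat_def using u(1) by blast
  then have "linked l w z"
    using linked_fat[OF W] w(1) fat_superset by blast
  then have "linked (Suc k) w z"
    using \<open>k < l\<close> by (intro linked_antimono[of "Suc k" l]) auto
  moreover have "linked (Suc k) x w"
    using \<open>k < l\<close> linked_sym[OF linked_antimono[OF _ w(2), of "Suc k"]] by simp
  ultimately show ?thesis
    unfolding envelope_def using v linked_trans by blast
qed

definition nest :: "('a \<Rightarrow> nat) \<Rightarrow> 'a \<Rightarrow> (nat \<times> 'a set) set" where
  "nest \<kappa> x = {(k, V). k \<le> \<kappa> x \<and> V \<in> N k \<and> x \<in> envelope k V}"

lemma nest_unique: "(k, V) \<in> nest \<kappa> x \<Longrightarrow> (k, W) \<in> nest \<kappa> x \<Longrightarrow> V = W"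
  unfolding nest_def using envelope_unique by blast

lemma inj_on_fst_nest: "inj_on fst (nest \<kappa> x)"
  using nest_unique by (fastforce intro: inj_onI)

lemma finite_nest: "finite (nest \<kappa> x)"
proof (rule inj_on_finite[OF inj_on_fst_nest])
  show "fst ` nest \<kappa> x \<subseteq> {..\<kappa> x}"
    unfolding nest_def by auto
qed simp

lemma nest_absorbs:
  assumes "(k, V) \<in> nest \<kappa> x" "(l, W) \<in> nest \<kappa> x" "k < l" "k \<le> \<kappa> y"
    and "x' \<in> envelope l W" "\<rho> x' y \<le> \<eta> * \<tau> l / 8"
  shows "(k, V) \<in> nest \<kappa> y"
  using assms envelope_absorbs[OF assms(3), of W x V x' y] unfolding nest_def by auto

lemma nest_initial:
  assumes "(k, V) \<in> nest \<kappa> x" "(l, W) \<in> nest \<kappa> x" "(l, W) \<in> nest \<kappa> y" "k \<le> l"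
  shows "(k, V) \<in> nest \<kappa> y"
proof (cases "k = l")
  case True
  then show ?thesis using assms nest_unique by blast
next
  case False
  then show ?thesis
    using assms margin_pos[of l] by (intro nest_absorbs[of k V \<kappa> x l W y y]) (auto simp: nest_def)
qed

lemma nest_nested: "nest \<kappa> x \<inter> nest \<kappa> y \<subseteq> nest \<kappa> z \<or> nest \<kappa> y \<inter> nest \<kappa> z \<subseteq> nest \<kappa> x"
proof (rule ccontr)
  assume "\<not> ?thesis"
  then obtain k V l W where
    "(k, V) \<in> nest \<kappa> x" "(k, V) \<in> nest \<kappa> y" "(k, V) \<notin> nest \<kappa> z"
    "(l, W) \<in> nest \<kappa> y" "(l, W) \<in> nest \<kappa> z" "(l, W) \<notin> nest \<kappa> x"
    by auto
  then show False
    using nest_initial[of k V \<kappa> y l W z] nest_initial[of l W \<kappa> y k V x] by linarith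
qed

lemma nest_common_imp_close:
  "(k, V) \<in> nest \<kappa> x \<Longrightarrow> (k, V) \<in> nest \<kappa> y \<Longrightarrow> \<rho> x y \<le> 2 * \<tau> k"
  unfolding nest_def using envelope_diam by auto

lemma far_level_in_nest_diff:
  assumes "V \<in> N k" "x \<in> V" "k \<le> \<kappa> x" "\<kappa> y < k \<or> 2 * \<tau> k < \<rho> x y"
  shows "k \<in> fst ` (nest \<kappa> x - nest \<kappa> y)"
proof -
  have x: "(k, V) \<in> nest \<kappa> x"
    using assms(1-3) envelope_superset unfolding nest_def by auto
  moreover have "(k, V) \<notin> nest \<kappa> y"
    using assms(4) nest_common_imp_close[OF x] unfolding nest_def by fastforce
  ultimately show ?thesis by force
qed

lemma close_level_le_nest_diff_level:
  assumes "\<rho> x y \<le> \<eta> * \<tau> l / 8" "l \<le> \<kappa> y" "l \<in> fst ` nest \<kappa> x"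
    and k: "k \<in> fst ` (nest \<kappa> x - nest \<kappa> y)"
  shows "l \<le> k"
proof (rule ccontr)
  assume "\<not> l \<le> k"
  obtain V W where V: "(k, V) \<in> nest \<kappa> x" "(k, V) \<notin> nest \<kappa> y" and W: "(l, W) \<in> nest \<kappa> x"
    using assms(3) k by force
  have "(k, V) \<in> nest \<kappa> y"
    using \<open>\<not> l \<le> k\<close> assms(1,2) W
    by (intro nest_absorbs[OF V(1) W, where x' = x]) (auto simp: nest_def)
  then show False using V(2) by blast
qed

lemma card_nest_diff_le:
  fixes \<alpha> \<beta> :: real
  assumes close: "\<And>l. real l < \<alpha> \<Longrightarrow> l \<le> \<kappa> y \<and> \<rho> x y \<le> \<eta> * \<tau> l / 8"
    and "real (\<kappa> x) \<le> \<beta>" "\<alpha> \<le> \<beta>"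
  shows "real (card (nest \<kappa> x - nest \<kappa> y)) \<le> \<beta> - \<alpha> + 2"
proof -
  define K where "K = fst ` (nest \<kappa> x - nest \<kappa> y)"
  have fin: "finite K"
    unfolding K_def using finite_nest by blast
  have "card (nest \<kappa> x - nest \<kappa> y) = card K"
    unfolding K_def using inj_on_subset[OF inj_on_fst_nest] by (intro card_image[symmetric]) blast
  moreover have "real (card (K - {Min K})) \<le> \<beta> - \<alpha> + 1"
  proof (rule card_nat_le_interval)
    fix l assume l: "l \<in> K - {Min K}"
    then have Min: "Min K \<in> K" "Min K < l"
      using fin by (auto intro!: Min_in simp: less_le)
    have l_nest: "l \<in> fst ` nest \<kappa> x" using l unfolding K_def by blast
    then show "real l \<le> \<beta>"
      using assms(2) unfolding nest_def by auto
    show "\<alpha> \<le> real l"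
      using close[of l] close_level_le_nest_diff_level[of x y l \<kappa> "Min K"] l_nest Min
      unfolding K_def by force
  qed (use fin assms(3) in auto)
  moreover have "card K \<le> card (K - {Min K}) + 1"
    using card_Suc_Diff1[OF fin, of "Min K"] by (cases "Min K \<in> K") auto
  ultimately show ?thesis by linarith
qed

end

locale colored_separated_families =
  fixes \<rho> :: "'a \<Rightarrow> 'a \<Rightarrow> real" and N :: "nat \<Rightarrow> nat \<Rightarrow> 'a set set"
    and \<tau> :: "nat \<Rightarrow> real" and \<eta> :: real and n :: nat
  assumes separated: "i < n \<Longrightarrow> separated_families \<rho> (N i) \<tau> \<eta>"
    and cover: "\<exists>i<n. x \<in> \<Union>(N i k)"
begin

definition color_nest :: "nat \<Rightarrow> ('a \<Rightarrow> nat) \<Rightarrow> 'a \<Rightarrow> (nat \<times> 'a set) set" where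
  "color_nest i = separated_families.nest \<rho> (N i) \<tau> \<eta>"

lemma sum_card_color_nest_diff_ge:
  fixes \<theta> :: real
  assumes "0 \<le> \<theta>"
    and apart: "\<And>k. \<theta> < real k \<Longrightarrow> k \<le> \<kappa> x \<Longrightarrow> \<kappa> y < k \<or> 2 * \<tau> k < \<rho> x y"
  shows "real (\<kappa> x) - \<theta> \<le> (\<Sum>i<n. real (card (color_nest i \<kappa> x - color_nest i \<kappa> y)))"
proof -
  define E where "E i = color_nest i \<kappa> x - color_nest i \<kappa> y" for i
  have fin: "finite (E i)" if "i < n" for i
    unfolding E_def color_nest_def
    using separated_families.finite_nest[OF separated[OF that]] by blast
  have "k \<in> (\<Union>i<n. fst ` E i)" if "k \<in> {nat \<lfloor>\<theta>\<rfloor> + 1..\<kappa> x}" for k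
  proof -
    have k: "\<theta> < real k" "k \<le> \<kappa> x"
      using that \<open>0 \<le> \<theta>\<close> by (auto, linarith)
    obtain i V where i: "i < n" "V \<in> N i k" "x \<in> V"
      using cover by blast
    have "k \<in> fst ` E i"
      unfolding E_def color_nest_def
      using separated[OF i(1)] i(2,3) k(2) apart[OF k]
      by (rule separated_families.far_level_in_nest_diff)
    then show ?thesis using i(1) by blast
  qed
  then have "{nat \<lfloor>\<theta>\<rfloor> + 1..\<kappa> x} \<subseteq> (\<Union>i<n. fst ` E i)" by blast
  then have "card {nat \<lfloor>\<theta>\<rfloor> + 1..\<kappa> x} \<le> card (\<Union>i<n. fst ` E i)"
    using fin by (intro card_mono) auto
  also have "\<dots> \<le> (\<Sum>i<n. card (fst ` E i))"
    by (rule card_UN_le) simp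
  also have "\<dots> \<le> (\<Sum>i<n. card (E i))"
    using fin by (intro sum_mono card_image_le) auto
  finally have "real (\<kappa> x - nat \<lfloor>\<theta>\<rfloor>) \<le> real (\<Sum>i<n. card (E i))"
    unfolding of_nat_le_iff by simp
  moreover have "real (\<kappa> x) - \<theta> \<le> real (\<kappa> x - nat \<lfloor>\<theta>\<rfloor>)"
    using \<open>0 \<le> \<theta>\<close> by linarith
  ultimately show ?thesis
    unfolding E_def by simp
qed

end

section \<open>The boundary map\<close>

lemma gromov_prod_commute: "gromov_prod p x y = gromov_prod p y x"
  unfolding gromov_prod_def by (simp add: dist_commute)

lemma gromov_prod_nonneg: "0 \<le> gromov_prod p x y"
  using dist_triangle[of x y p] unfolding gromov_prod_def by (simp add: dist_commute)

lemma gromov_prod_le: "gromov_prod p x y \<le> dist x p" "gromov_prod p x y \<le> dist y p"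
  using dist_triangle[of x p y] dist_triangle[of y p x]
  unfolding gromov_prod_def by (simp_all add: dist_commute)

lemma dist_eq_gromov_prod: "dist x y = dist x p + dist y p - 2 * gromov_prod p x y"
  unfolding gromov_prod_def by (simp add: field_simps)

lemma gromov_prod_change_base: "\<bar>gromov_prod p x y - gromov_prod q x y\<bar> \<le> dist p q"
  using dist_triangle[of x p q] dist_triangle[of x q p] dist_triangle[of y p q]
    dist_triangle[of y q p]
  unfolding gromov_prod_def by (simp add: dist_commute abs_le_iff field_simps)

definition hyperbolic_at :: "'a::metric_space \<Rightarrow> real \<Rightarrow> bool" where
  "hyperbolic_at p \<delta> \<longleftrightarrow>
     (\<forall>x y z. min (gromov_prod p x y) (gromov_prod p y z) - \<delta> \<le> gromov_prod p x z)"

lemma hyperbolic_at_nonneg: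
  assumes "hyperbolic_at p \<delta>"
  shows "0 \<le> \<delta>"
proof -
  have "min (gromov_prod p p p) (gromov_prod p p p) - \<delta> \<le> gromov_prod p p p"
    using assms unfolding hyperbolic_at_def by blast
  then show ?thesis by simp
qed

lemma hyperbolic_at_chain:
  assumes "hyperbolic_at p \<delta>"
  shows "min (gromov_prod p x y) (min (gromov_prod p y z) (gromov_prod p z w)) - 2 * \<delta>
    \<le> gromov_prod p x w"
proof -
  have "min (gromov_prod p x y) (gromov_prod p y w) - \<delta> \<le> gromov_prod p x w"
    "min (gromov_prod p y z) (gromov_prod p z w) - \<delta> \<le> gromov_prod p y w"
    using assms unfolding hyperbolic_at_def by blast+
  then show ?thesis
    using hyperbolic_at_nonneg[OF assms] by linarith
qed

lemma gromov_hyperbolic_imp_hyperbolic_at: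
  fixes p :: "'a::metric_space"
  assumes "gromov_hyperbolic TYPE('a)"
  obtains \<delta> where "hyperbolic_at p \<delta>"
proof -
  obtain \<delta> and q :: 'a
    where hyp: "\<And>x y z. min (gromov_prod q x y) (gromov_prod q y z) - \<delta> \<le> gromov_prod q x z"
    using assms unfolding gromov_hyperbolic_def by blast
  have "min (gromov_prod p x y) (gromov_prod p y z) - (\<delta> + 2 * dist p q) \<le> gromov_prod p x z"
    for x y z
    using hyp[of x y z] gromov_prod_change_base[of p x y q] gromov_prod_change_base[of p y z q]
      gromov_prod_change_base[of p x z q] by linarith
  then show ?thesis
    using that unfolding hyperbolic_at_def by blast
qed

lemma bdry_nonempty:
  assumes "\<xi> \<in> bdry b"
  obtains u where "u \<in> \<xi>"
proof -
  obtain x where x: "\<xi> = {y. conv_inf b y \<and> seq_equiv b x y}" "conv_inf b x"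
    using assms unfolding bdry_def by blast
  then have "x \<in> \<xi>"
    unfolding conv_inf_def seq_equiv_def by blast
  then show ?thesis using that by blast
qed

definition shadow :: "'a::metric_space \<Rightarrow> real \<Rightarrow> 'a \<Rightarrow> (nat \<Rightarrow> 'a) set set" where
  "shadow p C x = {\<xi>. \<forall>u\<in>\<xi>. \<forall>\<^sub>F i in sequentially. dist x p - C \<le> gromov_prod p x (u i)}"

lemma shadowD:
  "\<xi> \<in> shadow p C x \<Longrightarrow> u \<in> \<xi> \<Longrightarrow> \<forall>\<^sub>F i in sequentially. dist x p - C \<le> gromov_prod p x (u i)"
  unfolding shadow_def by blast

lemma shadow_change_base:
  assumes "\<xi> \<in> shadow q C x"
  shows "\<xi> \<in> shadow p (C + 2 * dist p q) x"
proof -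
  have "dist x p - (C + 2 * dist p q) \<le> gromov_prod p x v"
    if "dist x q - C \<le> gromov_prod q x v" for v
    using that gromov_prod_change_base[of p x v q] dist_triangle[of x p q]
    by (simp add: dist_commute)
  then show ?thesis
    using assms unfolding shadow_def by (blast intro: eventually_mono)
qed

lemma gromov_prod_pt_bdry_imp_shadow:
  assumes le: "ereal (dist x q) \<le> gromov_prod_pt_bdry q x \<xi> + ereal D" and "D < C"
  shows "\<xi> \<in> shadow q C x"
proof -
  have "\<forall>\<^sub>F i in sequentially. dist x q - C \<le> gromov_prod q x (u i)" if "u \<in> \<xi>" for u
  proof -
    let ?L = "liminf (\<lambda>i. ereal (gromov_prod q x (u i)))"
    have "gromov_prod_pt_bdry q x \<xi> \<le> ?L"
      unfolding gromov_prod_pt_bdry_def using that by (intro Inf_lower) blast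
    then have "ereal (dist x q) \<le> ?L + ereal D"
      using le by (meson add_right_mono order_trans)
    then have "ereal (dist x q - C) < ?L"
      using \<open>D < C\<close> by (cases ?L) auto
    then have "\<forall>\<^sub>F i in sequentially. ereal (dist x q - C) < ereal (gromov_prod q x (u i))"
      by (rule less_LiminfD)
    then show ?thesis
      by eventually_elim simp
  qed
  then show ?thesis unfolding shadow_def by blast
qed

lemma visual_space_shadow:
  fixes b p :: "'a::metric_space"
  assumes "visual_space b"
  obtains C and \<xi> :: "'a \<Rightarrow> (nat \<Rightarrow> 'a) set"
  where "0 \<le> C" "\<And>x. \<xi> x \<in> bdry b" "\<And>x. \<xi> x \<in> shadow p C x"
proof -
  obtain q :: 'a and D where "0 < D"
    and "\<forall>x. \<exists>\<xi>\<in>bdry b. ereal (dist x q) \<le> gromov_prod_pt_bdry q x \<xi> + ereal D"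
    using assms unfolding visual_space_def by blast
  then obtain \<xi> where \<xi>: "\<And>x. \<xi> x \<in> bdry b"
    and "\<And>x. ereal (dist x q) \<le> gromov_prod_pt_bdry q x (\<xi> x) + ereal D"
    by metis
  then have "\<xi> x \<in> shadow p (D + 1 + 2 * dist p q) x" for x
    by (intro shadow_change_base gromov_prod_pt_bdry_imp_shadow[of _ _ _ D]) auto
  then show ?thesis
    using that[of "D + 1 + 2 * dist p q" \<xi>] \<xi> \<open>0 < D\<close> by simp
qed

lemma gromov_prod_bdry_shadow_ge:
  assumes hyp: "hyperbolic_at p \<delta>" and "0 \<le> C"
    and \<xi>: "\<xi> \<in> shadow p C x" and \<zeta>: "\<zeta> \<in> shadow p C y"
  shows "ereal (gromov_prod p x y - C - 2 * \<delta>) \<le> gromov_prod_bdry p \<xi> \<zeta>"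
  unfolding gromov_prod_bdry_def
proof (rule Inf_greatest)
  fix L assume "L \<in> {liminf (\<lambda>i. ereal (gromov_prod p (u i) (v i))) |u v. u \<in> \<xi> \<and> v \<in> \<zeta>}"
  then obtain u v where uv: "u \<in> \<xi>" "v \<in> \<zeta>"
    and L: "L = liminf (\<lambda>i. ereal (gromov_prod p (u i) (v i)))" by blast
  have "\<forall>\<^sub>F i in sequentially.
      ereal (gromov_prod p x y - C - 2 * \<delta>) \<le> ereal (gromov_prod p (u i) (v i))"
    using shadowD[OF \<xi> uv(1)] shadowD[OF \<zeta> uv(2)]
  proof eventually_elim
    case (elim i)
    then show ?case
      using hyperbolic_at_chain[OF hyp, of "u i" x y "v i"] gromov_prod_le[of p x y]
        gromov_prod_commute[of p x "u i"] \<open>0 \<le> C\<close>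
      unfolding ereal_less_eq by linarith
  qed
  then show "ereal (gromov_prod p x y - C - 2 * \<delta>) \<le> L"
    unfolding L by (rule Liminf_bounded)
qed

lemma gromov_prod_bdry_shadow_le:
  assumes hyp: "hyperbolic_at p \<delta>"
    and \<xi>: "\<xi> \<in> shadow p C x" "u \<in> \<xi>" and \<zeta>: "\<zeta> \<in> shadow p C y" "v \<in> \<zeta>"
    and below: "gromov_prod p x y < min (dist x p) (dist y p) - (C + 2 * \<delta>)"
  shows "gromov_prod_bdry p \<xi> \<zeta> \<le> ereal (gromov_prod p x y + 2 * \<delta>)"
proof -
  have "\<forall>\<^sub>F i in sequentially.
      ereal (gromov_prod p (u i) (v i)) \<le> ereal (gromov_prod p x y + 2 * \<delta>)"
    using shadowD[OF \<xi>] shadowD[OF \<zeta>]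
  proof eventually_elim
    case (elim i)
    then show ?case
      using hyperbolic_at_chain[OF hyp, of x "u i" "v i" y] gromov_prod_commute[of p y "v i"] below
      unfolding ereal_less_eq by linarith
  qed
  then have "liminf (\<lambda>i. ereal (gromov_prod p (u i) (v i))) \<le> ereal (gromov_prod p x y + 2 * \<delta>)"
    by (intro Liminf_le) auto
  moreover have "gromov_prod_bdry p \<xi> \<zeta> \<le> liminf (\<lambda>i. ereal (gromov_prod p (u i) (v i)))"
    unfolding gromov_prod_bdry_def using \<xi>(2) \<zeta>(2) by (intro Inf_lower) blast
  ultimately show ?thesis by (rule order_trans[rotated])
qed

lemma exp_neg_le: "1 < a \<Longrightarrow> ereal s \<le> t \<Longrightarrow> exp_neg a t \<le> a powr - s"
  unfolding exp_neg_def by (cases t) (auto intro!: powr_mono)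

lemma exp_neg_ge: "1 < a \<Longrightarrow> t \<noteq> -\<infinity> \<Longrightarrow> t \<le> ereal s \<Longrightarrow> a powr - s \<le> exp_neg a t"
  unfolding exp_neg_def by (cases t) (auto intro!: powr_mono)

lemma exp_neg_gromov_prod_bdry_shadow_le:
  assumes "hyperbolic_at p \<delta>" "0 \<le> C" "\<xi> \<in> shadow p C x" "\<zeta> \<in> shadow p C y" and a: "1 < a"
  shows "exp_neg a (gromov_prod_bdry p \<xi> \<zeta>) \<le> a powr (C + 2 * \<delta>) * a powr - gromov_prod p x y"
proof -
  have "exp_neg a (gromov_prod_bdry p \<xi> \<zeta>) \<le> a powr - (gromov_prod p x y - C - 2 * \<delta>)"
    by (rule exp_neg_le[OF a gromov_prod_bdry_shadow_ge[OF assms(1-4)]])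
  then show ?thesis by (simp add: powr_add[symmetric] algebra_simps)
qed

lemma exp_neg_gromov_prod_bdry_shadow_ge:
  assumes hyp: "hyperbolic_at p \<delta>" and "0 \<le> C"
    and \<xi>: "\<xi> \<in> shadow p C x" "u \<in> \<xi>" and \<zeta>: "\<zeta> \<in> shadow p C y" "v \<in> \<zeta>" and a: "1 < a"
    and below: "gromov_prod p x y < min (dist x p) (dist y p) - (C + 2 * \<delta>)"
  shows "a powr (- 2 * \<delta>) * a powr - gromov_prod p x y \<le> exp_neg a (gromov_prod_bdry p \<xi> \<zeta>)"
proof -
  have "gromov_prod_bdry p \<xi> \<zeta> \<noteq> -\<infinity>"
    using gromov_prod_bdry_shadow_ge[OF hyp \<open>0 \<le> C\<close> \<xi>(1) \<zeta>(1)] by auto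
  then have "a powr - (gromov_prod p x y + 2 * \<delta>) \<le> exp_neg a (gromov_prod_bdry p \<xi> \<zeta>)"
    using gromov_prod_bdry_shadow_le[OF hyp \<xi> \<zeta> below] by (rule exp_neg_ge[OF a])
  then show ?thesis by (simp add: powr_add[symmetric] algebra_simps)
qed

lemma visual_boundary_map:
  fixes b :: "'a::metric_space" and d :: "(nat \<Rightarrow> 'a) set \<Rightarrow> (nat \<Rightarrow> 'a) set \<Rightarrow> real"
  assumes hyperbolic: "gromov_hyperbolic TYPE('a)"
    and visual: "visual_space b"
    and metric: "visual_metric b d"
  obtains p :: 'a and a A B D :: real and \<xi> :: "'a \<Rightarrow> (nat \<Rightarrow> 'a) set"
  where "1 < a" "0 < A" "0 < B" "\<And>x. \<xi> x \<in> bdry b"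
    "\<And>x y. d (\<xi> x) (\<xi> y) \<le> A * a powr - gromov_prod p x y"
    "\<And>x y. gromov_prod p x y < min (dist x p) (dist y p) - D \<Longrightarrow>
       B * a powr - gromov_prod p x y \<le> d (\<xi> x) (\<xi> y)"
proof -
  obtain p :: 'a and a c1 c2 where a: "1 < a" and c1: "0 < c1" and c2: "0 < c2"
    and d: "\<forall>\<xi>\<in>bdry b. \<forall>\<zeta>\<in>bdry b. c1 * exp_neg a (gromov_prod_bdry p \<xi> \<zeta>) \<le> d \<xi> \<zeta> \<and>
        d \<xi> \<zeta> \<le> c2 * exp_neg a (gromov_prod_bdry p \<xi> \<zeta>)"
    using metric unfolding visual_metric_def by blast
  obtain \<delta> where hyp: "hyperbolic_at p \<delta>"
    using gromov_hyperbolic_imp_hyperbolic_at[OF hyperbolic] .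
  obtain C \<xi> where C: "0 \<le> C" and \<xi>: "\<And>x. \<xi> x \<in> bdry b" and shadow: "\<And>x. \<xi> x \<in> shadow p C x"
    using visual_space_shadow[OF visual, of p] by blast
  have upper: "d (\<xi> x) (\<xi> y) \<le> c2 * a powr (C + 2 * \<delta>) * a powr - gromov_prod p x y" for x y
  proof -
    have "d (\<xi> x) (\<xi> y) \<le> c2 * exp_neg a (gromov_prod_bdry p (\<xi> x) (\<xi> y))"
      using d \<xi> by blast
    also have "\<dots> \<le> c2 * (a powr (C + 2 * \<delta>) * a powr - gromov_prod p x y)"
      using c2 exp_neg_gromov_prod_bdry_shadow_le[OF hyp C shadow shadow a]
      by (intro mult_left_mono) auto
    finally show ?thesis by (simp only: mult.assoc)
  qed
  have lower: "c1 * a powr (- 2 * \<delta>) * a powr - gromov_prod p x y \<le> d (\<xi> x) (\<xi> y)"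
    if below: "gromov_prod p x y < min (dist x p) (dist y p) - (C + 2 * \<delta>)" for x y
  proof -
    obtain u v where uv: "u \<in> \<xi> x" "v \<in> \<xi> y"
      using bdry_nonempty \<xi> by metis
    have "c1 * (a powr (- 2 * \<delta>) * a powr - gromov_prod p x y)
        \<le> c1 * exp_neg a (gromov_prod_bdry p (\<xi> x) (\<xi> y))"
      using c1 exp_neg_gromov_prod_bdry_shadow_ge[OF hyp C shadow uv(1) shadow uv(2) a below]
      by (intro mult_left_mono) auto
    also have "\<dots> \<le> d (\<xi> x) (\<xi> y)"
      using d \<xi> by blast
    finally show ?thesis by (simp only: mult.assoc)
  qed
  show ?thesis
    by (rule that[OF a _ _ \<xi> upper lower]) (use a c1 c2 in auto)
qed

section \<open>Separated coverings from the capacity dimension\<close>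

definition separated_cover ::
    "'b set \<Rightarrow> ('b \<Rightarrow> 'b \<Rightarrow> real) \<Rightarrow> nat \<Rightarrow> real \<Rightarrow> real \<Rightarrow> (nat \<Rightarrow> 'b set set) \<Rightarrow> bool" where
  "separated_cover Z d n \<tau> \<epsilon> \<W> \<longleftrightarrow> (\<forall>z\<in>Z. \<exists>i<n. z \<in> \<Union>(\<W> i)) \<and>
     (\<forall>i<n. \<forall>V\<in>\<W> i. \<forall>v\<in>V. \<forall>w\<in>V. d v w \<le> \<tau>) \<and>
     (\<forall>i<n. \<forall>V\<in>\<W> i. \<forall>W\<in>\<W> i. V \<noteq> W \<longrightarrow> (\<forall>v\<in>V. \<forall>w\<in>W. \<epsilon> \<le> d v w))"

lemma separated_coverD:
  assumes "separated_cover Z d n \<tau> \<epsilon> \<W>"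
  shows "z \<in> Z \<Longrightarrow> \<exists>i<n. z \<in> \<Union>(\<W> i)"
    and "i < n \<Longrightarrow> V \<in> \<W> i \<Longrightarrow> v \<in> V \<Longrightarrow> w \<in> V \<Longrightarrow> d v w \<le> \<tau>"
    and "i < n \<Longrightarrow> V \<in> \<W> i \<Longrightarrow> W \<in> \<W> i \<Longrightarrow> V \<noteq> W \<Longrightarrow> v \<in> V \<Longrightarrow> w \<in> W \<Longrightarrow> \<epsilon> \<le> d v w"
  using assms unfolding separated_cover_def by simp_all

definition inner_core :: "'b set \<Rightarrow> ('b \<Rightarrow> 'b \<Rightarrow> real) \<Rightarrow> real \<Rightarrow> 'b set \<Rightarrow> 'b set" where
  "inner_core Z d r U = {z \<in> Z. ereal r < setdist_on d z (Z - U)}"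

lemma inner_core_far:
  assumes "z \<in> inner_core Z d r U" "w \<in> Z - U"
  shows "r < d z w"
proof -
  have "ereal r < setdist_on d z (Z - U)"
    using assms(1) unfolding inner_core_def by simp
  also have "\<dots> \<le> ereal (d z w)"
    unfolding setdist_on_def using assms(2) by (rule INF_lower)
  finally show ?thesis by simp
qed

lemma inner_core_subset:
  assumes "metric_on Z d" "0 \<le> r"
  shows "inner_core Z d r U \<subseteq> U"
proof
  fix z assume z: "z \<in> inner_core Z d r U"
  then have "z \<in> Z" unfolding inner_core_def by simp
  then have "d z z = 0" using metric_on_eq_0_iff[OF assms(1)] by blast
  then show "z \<in> U"
    using inner_core_far[OF z, of z] \<open>z \<in> Z\<close> assms(2) by auto
qed

lemma inner_cores_cover:
  assumes "ereal r < lebesgue_num Z d \<U>" "z \<in> Z"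
  obtains U where "U \<in> \<U>" "z \<in> inner_core Z d r U"
proof -
  have "lebesgue_num Z d \<U> \<le> (SUP U\<in>\<U>. setdist_on d z (Z - U))"
    using INF_lower[OF assms(2), of "lebesgue_at Z d \<U>"]
    unfolding lebesgue_num_def lebesgue_at_def by simp
  then have "ereal r < (SUP U\<in>\<U>. setdist_on d z (Z - U))"
    using assms(1) less_le_trans by blast
  then show ?thesis
    using that assms(2) unfolding less_SUP_iff inner_core_def by blast
qed

lemma dist_le_mesh:
  assumes "U \<in> \<U>" "x \<in> U" "y \<in> U"
  shows "ereal (d x y) \<le> mesh d \<U>"
proof -
  have "ereal (d x y) \<le> diam_on d U"
    unfolding diam_on_def using assms(2,3) by (intro Sup_upper) blast
  also have "\<dots> \<le> mesh d \<U>"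
    unfolding mesh_def using assms(1) by (rule SUP_upper)
  finally show ?thesis .
qed

lemma separated_cover_of_colored_cover:
  assumes met: "metric_on Z d" and "0 \<le> r"
    and colored: "colored n \<U>" and mesh: "mesh d \<U> \<le> ereal \<tau>"
    and lebesgue: "ereal r < lebesgue_num Z d \<U>"
  shows "\<exists>\<W>. separated_cover Z d n \<tau> r \<W>"
proof -
  obtain \<V> where \<V>: "\<U> = (\<Union>i<n. \<V> i)" "\<And>i. i < n \<Longrightarrow> disjoint (\<V> i)"
    using colored unfolding colored_def by blast
  note core_subset = inner_core_subset[OF met \<open>0 \<le> r\<close>]
  have "\<exists>i<n. z \<in> \<Union>(inner_core Z d r ` \<V> i)" if "z \<in> Z" for z
    using inner_cores_cover[OF lebesgue that] \<V>(1) by blast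
  moreover have "d v w \<le> \<tau>"
    if "i < n" "U \<in> \<V> i" "v \<in> inner_core Z d r U" "w \<in> inner_core Z d r U" for i U v w
  proof -
    have "ereal (d v w) \<le> mesh d \<U>"
      using that \<V>(1) core_subset by (intro dist_le_mesh[of U]) auto
    then show ?thesis
      using order_trans[OF _ mesh] by fastforce
  qed
  moreover have "r \<le> d v w"
    if "i < n" "U \<in> \<V> i" "U' \<in> \<V> i" "inner_core Z d r U \<noteq> inner_core Z d r U'"
      "v \<in> inner_core Z d r U" "w \<in> inner_core Z d r U'" for i U U' v w
  proof -
    have "U \<inter> U' = {}"
      using disjointD[OF \<V>(2)[OF that(1)] that(2,3)] that(4) by blast
    then have "w \<in> Z - U"
      using core_subset that(6) unfolding inner_core_def by fastforce
    then show ?thesis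
      using inner_core_far[OF that(5)] by fastforce
  qed
  ultimately have "separated_cover Z d n \<tau> r (\<lambda>i. inner_core Z d r ` \<V> i)"
    unfolding separated_cover_def by blast
  then show ?thesis by blast
qed

lemma cdim_le_imp_separated_cover:
  assumes met: "metric_on Z d" and dim: "cdim_le Z d m"
  obtains \<eta> \<tau>0 :: real where "0 < \<eta>" "\<eta> \<le> 1" "0 < \<tau>0"
    "\<And>\<tau>. 0 < \<tau> \<Longrightarrow> \<tau> \<le> \<tau>0 \<Longrightarrow> \<exists>\<W>. separated_cover Z d (m + 1) \<tau> (\<eta> * \<tau>) \<W>"
proof -
  obtain \<delta> \<tau>0 where "0 < \<delta>" "0 < \<tau>0"
    and cov: "\<And>\<tau>. 0 < \<tau> \<Longrightarrow> \<tau> \<le> \<tau>0 \<Longrightarrow> \<exists>\<U>. open_covering Z d \<U> \<and> colored (m + 1) \<U> \<and>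
            mesh d \<U> \<le> ereal \<tau> \<and> ereal (\<delta> * \<tau>) \<le> lebesgue_num Z d \<U>"
    using dim unfolding cdim_le_def by blast
  define \<eta> where "\<eta> = min 1 (\<delta> / 2)"
  have \<eta>: "0 < \<eta>" "\<eta> \<le> 1" "\<eta> < \<delta>"
    unfolding \<eta>_def using \<open>0 < \<delta>\<close> by auto
  have "\<exists>\<W>. separated_cover Z d (m + 1) \<tau> (\<eta> * \<tau>) \<W>" if \<tau>: "0 < \<tau>" "\<tau> \<le> \<tau>0" for \<tau>
  proof -
    obtain \<U> where \<U>: "colored (m + 1) \<U>" "mesh d \<U> \<le> ereal \<tau>" "ereal (\<delta> * \<tau>) \<le> lebesgue_num Z d \<U>"
      using cov[OF \<tau>] by blast
    have "ereal (\<eta> * \<tau>) < lebesgue_num Z d \<U>"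
      using less_le_trans[OF _ \<U>(3)] \<eta>(3) \<tau>(1) by simp
    then show ?thesis
      using separated_cover_of_colored_cover[OF met _ \<U>(1,2)] \<eta>(1) \<tau>(1) by simp
  qed
  then show ?thesis
    using that \<eta>(1,2) \<open>0 < \<tau>0\<close> by blast
qed

lemma cdim_le_the_enat_cdim:
  assumes "cdim Z d < \<infinity>"
  shows "cdim_le Z d (the_enat (cdim Z d))"
proof -
  have "\<exists>m. cdim_le Z d m"
    using assms unfolding cdim_def by (auto split: if_splits)
  then show ?thesis
    unfolding cdim_def using LeastI_ex[of "cdim_le Z d"] by simp
qed

section \<open>The embedding\<close>

lemma sum_le_prod_dist: "(\<Sum>i<n. dT i (p i) (q i)) \<le> real n * prod_dist n dT p q"
proof -
  have "dT i (p i) (q i) \<le> prod_dist n dT p q" if "i < n" for i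
    using member_le_L2_set[of "{..<n}" i "\<lambda>i. dT i (p i) (q i)"] that
    unfolding prod_dist_def L2_set_def by simp
  then show ?thesis
    using sum_bounded_above[of "{..<n}" "\<lambda>i. dT i (p i) (q i)" "prod_dist n dT p q"] by simp
qed

lemma prod_dist_le_sum:
  assumes "\<And>i. i < n \<Longrightarrow> 0 \<le> dT i (p i) (q i)"
  shows "prod_dist n dT p q \<le> (\<Sum>i<n. dT i (p i) (q i))"
  using L2_set_le_sum[of "{..<n}" "\<lambda>i. dT i (p i) (q i)"] assms
  unfolding prod_dist_def L2_set_def by simp

lemma qi_embedding_prod_distI:
  fixes f :: "'a \<Rightarrow> nat \<Rightarrow> 'b" and dX :: "'a \<Rightarrow> 'a \<Rightarrow> real"
  assumes "0 < n" "0 < \<omega>" "0 \<le> E" "0 \<le> E'"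
    and dX_nonneg: "\<And>x y. 0 \<le> dX x y"
    and nonneg: "\<And>i x y. i < n \<Longrightarrow> 0 \<le> dT i (f x i) (f y i)"
    and upper: "\<And>i x y. i < n \<Longrightarrow> dT i (f x i) (f y i) \<le> dX x y / \<omega> + E"
    and lower: "\<And>x y. dX x y / \<omega> - E' \<le> (\<Sum>i<n. dT i (f x i) (f y i))"
  shows "qi_embedding dX (prod_dist n dT) f"
proof -
  define \<Lambda> where "\<Lambda> = 1 + real n / \<omega> + real n * \<omega>"
  define \<sigma> where "\<sigma> = real n * E + E' / real n"
  have "1 \<le> \<Lambda>" "0 \<le> \<sigma>"
    unfolding \<Lambda>_def \<sigma>_def using assms(1-4) by auto
  moreover have "dX x y / \<Lambda> - \<sigma> \<le> prod_dist n dT (f x) (f y)" for x y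
  proof -
    have "dX x y / \<Lambda> \<le> dX x y / (real n * \<omega>)"
      using assms(1,2) dX_nonneg unfolding \<Lambda>_def
      by (intro divide_left_mono) (auto intro!: mult_pos_pos add_pos_pos)
    moreover have "dX x y / \<omega> - E' \<le> real n * prod_dist n dT (f x) (f y)"
      using lower sum_le_prod_dist by (rule order_trans)
    then have "dX x y / (real n * \<omega>) - E' / real n \<le> prod_dist n dT (f x) (f y)"
      using assms(1,2) by (simp add: field_simps)
    moreover have "E' / real n \<le> \<sigma>"
      unfolding \<sigma>_def using assms(3) by simp
    ultimately show ?thesis by linarith
  qed
  moreover have "prod_dist n dT (f x) (f y) \<le> \<Lambda> * dX x y + \<sigma>" for x y
  proof -
    have "prod_dist n dT (f x) (f y) \<le> (\<Sum>i<n. dT i (f x i) (f y i))"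
      using nonneg by (rule prod_dist_le_sum)
    also have "\<dots> \<le> real n * (dX x y / \<omega> + E)"
      using sum_bounded_above[of "{..<n}" "\<lambda>i. dT i (f x i) (f y i)" "dX x y / \<omega> + E"] upper
      by simp
    also have "\<dots> = real n / \<omega> * dX x y + real n * E"
      by (simp add: algebra_simps)
    also have "\<dots> \<le> \<Lambda> * dX x y + \<sigma>"
      unfolding \<Lambda>_def \<sigma>_def using assms(1-4) dX_nonneg by (intro add_mono mult_right_mono) auto
    finally show ?thesis .
  qed
  ultimately show ?thesis
    unfolding qi_embedding_def by blast
qed

locale visual_separated_families = colored_separated_families \<rho> N \<tau> \<eta> n
  for \<rho> :: "'a::metric_space \<Rightarrow> 'a \<Rightarrow> real" and N \<tau> \<eta> n +
  fixes p :: 'a and \<omega> C :: real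
  assumes \<omega>_pos: "0 < \<omega>" and C_nonneg: "0 \<le> C"
    and close_below_branching: "\<omega> * real k + C < gromov_prod p x y \<Longrightarrow> \<rho> x y \<le> \<eta> * \<tau> k / 8"
    and far_above_branching: "gromov_prod p x y + C < \<omega> * real k \<Longrightarrow> \<omega> * real k \<le> dist x p \<Longrightarrow>
      \<omega> * real k \<le> dist y p \<Longrightarrow> 2 * \<tau> k < \<rho> x y"
begin

definition level :: "'a \<Rightarrow> nat" where
  "level x = nat \<lfloor>dist x p / \<omega>\<rfloor>"

definition branch :: "nat \<Rightarrow> 'a \<Rightarrow> (nat \<times> 'a set) set" where
  "branch i = color_nest i level"

lemma le_level_iff: "k \<le> level x \<longleftrightarrow> \<omega> * real k \<le> dist x p"
proof -
  have "k \<le> level x \<longleftrightarrow> real k \<le> dist x p / \<omega>"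
    unfolding level_def using \<omega>_pos by (simp add: le_nat_iff le_floor_iff)
  then show ?thesis
    using \<omega>_pos by (simp add: field_simps)
qed

lemma level_bounds: "real (level x) \<le> dist x p / \<omega>" "dist x p / \<omega> - 1 \<le> real (level x)"
  using \<omega>_pos unfolding level_def by (auto simp: of_nat_floor)

lemma n_pos: "0 < n"
  using cover[of undefined 0] by auto

lemma card_branch_diff_le:
  assumes "i < n"
  shows "real (card (branch i x - branch i y)) \<le> (dist x p - gromov_prod p x y + C) / \<omega> + 2"
proof -
  have "real (card (branch i x - branch i y)) \<le> dist x p / \<omega> - (gromov_prod p x y - C) / \<omega> + 2"
    unfolding branch_def color_nest_def
  proof (rule separated_families.card_nest_diff_le[OF separated[OF assms]])
    fix k assume "real k < (gromov_prod p x y - C) / \<omega>"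
    then have k: "\<omega> * real k + C < gromov_prod p x y"
      using \<omega>_pos by (simp add: field_simps)
    then have "k \<le> level y"
      unfolding le_level_iff using gromov_prod_le(2)[of p x y] C_nonneg by linarith
    then show "k \<le> level y \<and> \<rho> x y \<le> \<eta> * \<tau> k / 8"
      using close_below_branching[OF k] by simp
  next
    show "real (level x) \<le> dist x p / \<omega>" by (rule level_bounds)
    show "(gromov_prod p x y - C) / \<omega> \<le> dist x p / \<omega>"
      using \<omega>_pos C_nonneg gromov_prod_le(1)[of p x y] by (intro divide_right_mono) auto
  qed
  then show ?thesis
    by (simp add: add_divide_distrib diff_divide_distrib)
qed

lemma sum_card_branch_diff_ge:
  "(dist x p - gromov_prod p x y - C) / \<omega> - 1 \<le> (\<Sum>i<n. real (card (branch i x - branch i y)))"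
proof -
  have "real (level x) - (gromov_prod p x y + C) / \<omega>
      \<le> (\<Sum>i<n. real (card (branch i x - branch i y)))"
    unfolding branch_def
  proof (rule sum_card_color_nest_diff_ge)
    show "0 \<le> (gromov_prod p x y + C) / \<omega>"
      using \<omega>_pos C_nonneg gromov_prod_nonneg[of p x y] by simp
  next
    fix k assume "(gromov_prod p x y + C) / \<omega> < real k" and x: "k \<le> level x"
    then have k: "gromov_prod p x y + C < \<omega> * real k"
      using \<omega>_pos by (simp add: field_simps)
    show "level y < k \<or> 2 * \<tau> k < \<rho> x y"
      using far_above_branching[OF k] x le_level_iff by (meson not_le)
  qed
  then show ?thesis
    using level_bounds(2)[of x] by (simp add: add_divide_distrib diff_divide_distrib)
qed

lemma branch_tree:
  assumes "i < n"
  shows "\<exists>(T :: ('a \<times> real) set) dT f. metric_tree T dT \<and> (\<forall>x. f x \<in> T) \<and>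
    (\<forall>x y. dT (f x) (f y) =
       real (card (branch i x - branch i y)) + real (card (branch i y - branch i x)))"
  unfolding branch_def color_nest_def
  by (rule tree_of_nested_sets[OF separated_families.finite_nest[OF separated[OF assms]]
        separated_families.nest_nested[OF separated[OF assms]]])

lemma qi_embedding_into_trees:
  "\<exists>(T :: nat \<Rightarrow> ('a \<times> real) set) dT (f :: 'a \<Rightarrow> nat \<Rightarrow> 'a \<times> real).
     (\<forall>i<n. metric_tree (T i) (dT i)) \<and>
     (\<forall>x. \<forall>i<n. f x i \<in> T i) \<and> qi_embedding dist (prod_dist n dT) f"
proof -
  obtain T :: "nat \<Rightarrow> ('a \<times> real) set" and dT F where
    tree: "\<And>i. i < n \<Longrightarrow> metric_tree (T i) (dT i)" "\<And>i x. i < n \<Longrightarrow> F i x \<in> T i"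
    and dT: "\<And>i x y. i < n \<Longrightarrow> dT i (F i x) (F i y) =
      real (card (branch i x - branch i y)) + real (card (branch i y - branch i x))"
    using branch_tree by metis
  have "qi_embedding dist (prod_dist n dT) (\<lambda>x i. F i x)"
  proof (rule qi_embedding_prod_distI[OF n_pos \<omega>_pos])
    show "0 \<le> 2 * C / \<omega> + 4" "0 \<le> 2 * C / \<omega> + 2"
      using C_nonneg \<omega>_pos by simp_all
  next
    fix i x y assume "i < n"
    then show "dT i (F i x) (F i y) \<le> dist x y / \<omega> + (2 * C / \<omega> + 4)"
      using card_branch_diff_le[of i x y] card_branch_diff_le[of i y x]
      unfolding dT[OF \<open>i < n\<close>] dist_eq_gromov_prod[of x y p] gromov_prod_commute[of p y x]
      by (simp add: add_divide_distrib diff_divide_distrib)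
  next
    fix x y
    have "(\<Sum>i<n. dT i (F i x) (F i y)) = (\<Sum>i<n. real (card (branch i x - branch i y)))
        + (\<Sum>i<n. real (card (branch i y - branch i x)))"
      unfolding sum.distrib[symmetric] using dT by (intro sum.cong) auto
    then show "dist x y / \<omega> - (2 * C / \<omega> + 2) \<le> (\<Sum>i<n. dT i (F i x) (F i y))"
      using sum_card_branch_diff_ge[of x y] sum_card_branch_diff_ge[of y x]
      unfolding dist_eq_gromov_prod[of x y p] gromov_prod_commute[of p y x]
      by (simp add: add_divide_distrib diff_divide_distrib)
  qed (simp_all add: dT)
  then show ?thesis
    using tree by (intro exI[of _ T] exI[of _ dT] exI[of _ "\<lambda>x i. F i x"]) simp
qed

end

lemma colored_separated_families_vimage:
  assumes met: "metric_on Z d" and \<xi>: "\<And>x. \<xi> x \<in> Z"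
    and \<eta>: "0 < \<eta>" "\<eta> \<le> 1" and \<tau>: "\<And>k. 0 < \<tau> k" "\<And>k. \<tau> (Suc k) \<le> \<eta> / 16 * \<tau> k"
    and cover: "\<And>k. separated_cover Z d n (\<tau> k) (\<eta> * \<tau> k) (\<W> k)"
  shows "colored_separated_families (\<lambda>x y. d (\<xi> x) (\<xi> y)) (\<lambda>i k. vimage \<xi> ` \<W> k i) \<tau> \<eta> n"
proof (rule colored_separated_families.intro)
  fix i assume "i < n"
  show "separated_families (\<lambda>x y. d (\<xi> x) (\<xi> y)) (\<lambda>k. vimage \<xi> ` \<W> k i) \<tau> \<eta>"
  proof
    fix x y z
    show "d (\<xi> x) (\<xi> x) = 0"
      using metric_on_eq_0_iff[OF met \<xi> \<xi>] by simp
    show "d (\<xi> x) (\<xi> y) = d (\<xi> y) (\<xi> x)"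
      by (rule metric_on_commute[OF met \<xi> \<xi>])
    show "d (\<xi> x) (\<xi> z) \<le> d (\<xi> x) (\<xi> y) + d (\<xi> y) (\<xi> z)"
      by (rule metric_on_triangle[OF met \<xi> \<xi> \<xi>])
  next
    fix V k v w assume "V \<in> vimage \<xi> ` \<W> k i" "v \<in> V" "w \<in> V"
    then obtain V' where "V' \<in> \<W> k i" "\<xi> v \<in> V'" "\<xi> w \<in> V'" by auto
    then show "d (\<xi> v) (\<xi> w) \<le> \<tau> k"
      by (rule separated_coverD(2)[OF cover \<open>i < n\<close>])
  next
    fix V W k v w
    assume "V \<in> vimage \<xi> ` \<W> k i" "W \<in> vimage \<xi> ` \<W> k i" "V \<noteq> W" "v \<in> V" "w \<in> W"
    then obtain V' W' where "V' \<in> \<W> k i" "W' \<in> \<W> k i" "V' \<noteq> W'" "\<xi> v \<in> V'" "\<xi> w \<in> W'"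
      by auto
    then show "\<eta> * \<tau> k \<le> d (\<xi> v) (\<xi> w)"
      by (rule separated_coverD(3)[OF cover \<open>i < n\<close>])
  qed (fact \<eta> \<tau>)+
next
  fix x k
  have "\<exists>i<n. \<xi> x \<in> \<Union> (\<W> k i)"
    by (rule separated_coverD(1)[OF cover \<xi>])
  then show "\<exists>i<n. x \<in> \<Union> (vimage \<xi> ` \<W> k i)"
    by simp
qed

lemma powr_absorb_factor:
  fixes a P Q :: real
  assumes "1 < a" "0 < P" "0 < Q"
  obtains C where "\<And>s t. s + C < t \<Longrightarrow> P * a powr - t < Q * a powr - s"
proof (rule that)
  fix s t assume "s + log a (P / Q) < t"
  have "P * a powr - t = Q * a powr (log a (P / Q) - t)"
    using assms by (simp add: powr_diff powr_minus divide_inverse)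
  also have "\<dots> < Q * a powr - s"
    using assms \<open>s + log a (P / Q) < t\<close>
    by (intro mult_strict_left_mono powr_less_mono) auto
  finally show "P * a powr - t < Q * a powr - s" .
qed

lemma powr_neg_log_inverse:
  fixes a q :: real
  assumes "1 < a" "0 < q"
  shows "a powr - (log a (1 / q) * real k) = q ^ k"
proof -
  have "a powr - (log a (1 / q) * real k) = (a powr - log a (1 / q)) powr real k"
    by (simp add: powr_powr)
  also have "a powr - log a (1 / q) = q"
    using assms by (simp add: powr_minus)
  finally show ?thesis
    using assms(2) by (simp add: powr_realpow)
qed

text \<open>A level \<open>k\<close> corresponds to the height \<open>\<omega> * k\<close> in \<open>X\<close>, where \<open>\<omega>\<close> is chosen such that
  \<open>a powr - (\<omega> * k) = q ^ k\<close>; the multiplicative constants of the visual metric then become the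
  additive constant \<open>C\<close>.\<close>
lemma visual_separated_familiesI:
  fixes \<rho> :: "'a::metric_space \<Rightarrow> 'a \<Rightarrow> real"
  assumes fam: "colored_separated_families \<rho> N \<tau> \<eta> n" and "0 < \<eta>"
    and \<tau>: "\<And>k. \<tau> k = \<tau>0 * q ^ k" and "0 < \<tau>0" "0 < q" "q < 1"
    and a: "1 < a" and A: "0 < A" and B: "0 < B"
    and upper: "\<And>x y. \<rho> x y \<le> A * a powr - gromov_prod p x y"
    and lower: "\<And>x y. gromov_prod p x y < min (dist x p) (dist y p) - D \<Longrightarrow>
      B * a powr - gromov_prod p x y \<le> \<rho> x y"
  shows "\<exists>\<omega> C. visual_separated_families \<rho> N \<tau> \<eta> n p \<omega> C"
proof -
  define \<omega> where "\<omega> = log a (1 / q)"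
  have \<tau>_powr: "\<tau> k = \<tau>0 * a powr - (\<omega> * real k)" for k
    unfolding \<omega>_def \<tau> powr_neg_log_inverse[OF a \<open>0 < q\<close>] ..
  obtain C1 where absorb_A: "\<And>s t. s + C1 < t \<Longrightarrow> A * a powr - t < \<eta> / 8 * \<tau>0 * a powr - s"
    using powr_absorb_factor[OF a A, of "\<eta> / 8 * \<tau>0"] \<open>0 < \<eta>\<close> \<open>0 < \<tau>0\<close> by auto
  obtain C2 where absorb_B: "\<And>s t. s + C2 < t \<Longrightarrow> 2 * \<tau>0 * a powr - t < B * a powr - s"
    using powr_absorb_factor[OF a _ B, of "2 * \<tau>0"] \<open>0 < \<tau>0\<close> by auto
  define C where "C = Max {0, D, C1, C2}"
  have C: "0 \<le> C" "D \<le> C" "C1 \<le> C" "C2 \<le> C"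
    unfolding C_def by simp_all
  have "visual_separated_families_axioms \<rho> \<tau> \<eta> p \<omega> C"
  proof
    show "0 < \<omega>" "0 \<le> C"
      using a \<open>0 < q\<close> \<open>q < 1\<close> C(1) unfolding \<omega>_def by simp_all
  next
    fix k x y assume "\<omega> * real k + C < gromov_prod p x y"
    then have "A * a powr - gromov_prod p x y < \<eta> / 8 * \<tau>0 * a powr - (\<omega> * real k)"
      using C(3) by (intro absorb_A) simp
    then show "\<rho> x y \<le> \<eta> * \<tau> k / 8"
      using upper[of x y] unfolding \<tau>_powr by simp
  next
    fix k x y
    assume k: "gromov_prod p x y + C < \<omega> * real k" "\<omega> * real k \<le> dist x p" "\<omega> * real k \<le> dist y p"
    have "B * a powr - gromov_prod p x y \<le> \<rho> x y"
      using k C(2) by (intro lower) auto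
    moreover have "2 * \<tau>0 * a powr - (\<omega> * real k) < B * a powr - gromov_prod p x y"
      using k(1) C(4) by (intro absorb_B) simp
    ultimately show "2 * \<tau> k < \<rho> x y"
      unfolding \<tau>_powr by simp
  qed
  then show ?thesis
    using fam visual_separated_families.intro by blast
qed

lemma visual_separated_families_exist:
  fixes b :: "'a::metric_space" and d :: "(nat \<Rightarrow> 'a) set \<Rightarrow> (nat \<Rightarrow> 'a) set \<Rightarrow> real"
  assumes "gromov_hyperbolic TYPE('a)" "visual_space b" "visual_metric b d"
    and dim: "cdim_le (bdry b) d m"
  shows "\<exists>(\<rho> :: 'a \<Rightarrow> 'a \<Rightarrow> real) N \<tau> \<eta> p \<omega> C.
    visual_separated_families \<rho> N \<tau> \<eta> (m + 1) p \<omega> C"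
proof -
  have met: "metric_on (bdry b) d"
    using assms(3) unfolding visual_metric_def by blast
  obtain p :: 'a and a A B D \<xi> where scale: "1 < a" "0 < A" "0 < B"
    and \<xi>: "\<And>x. \<xi> x \<in> bdry b"
    and upper: "\<And>x y. d (\<xi> x) (\<xi> y) \<le> A * a powr - gromov_prod p x y"
    and lower: "\<And>x y. gromov_prod p x y < min (dist x p) (dist y p) - D \<Longrightarrow>
      B * a powr - gromov_prod p x y \<le> d (\<xi> x) (\<xi> y)"
    by (rule visual_boundary_map[OF assms(1-3)]) (rule that; fast)
  obtain \<eta> \<tau>0 where \<eta>: "0 < \<eta>" "\<eta> \<le> 1" and \<tau>0: "0 < \<tau>0"
    and cover: "\<And>\<tau>. 0 < \<tau> \<Longrightarrow> \<tau> \<le> \<tau>0 \<Longrightarrow>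
      \<exists>\<W>. separated_cover (bdry b) d (m + 1) \<tau> (\<eta> * \<tau>) \<W>"
    using cdim_le_imp_separated_cover[OF met dim] by metis
  define \<tau> where "\<tau> k = \<tau>0 * (\<eta> / 16) ^ k" for k
  have \<tau>: "0 < \<tau> k" "\<tau> k \<le> \<tau>0" "\<tau> (Suc k) \<le> \<eta> / 16 * \<tau> k" for k
    unfolding \<tau>_def using \<eta> \<tau>0 by (auto simp: mult_le_cancel_left1 power_le_one)
  obtain \<W> where \<W>: "\<And>k. separated_cover (bdry b) d (m + 1) (\<tau> k) (\<eta> * \<tau> k) (\<W> k)"
    using cover[OF \<tau>(1,2)] by metis
  have "\<exists>\<omega> C. visual_separated_families (\<lambda>x y. d (\<xi> x) (\<xi> y)) (\<lambda>i k. vimage \<xi> ` \<W> k i)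
      \<tau> \<eta> (m + 1) p \<omega> C"
    using \<eta> \<tau>0 by (intro visual_separated_familiesI[OF _ _ \<tau>_def _ _ _ scale upper lower]
      colored_separated_families_vimage[where \<xi> = \<xi> and \<tau> = \<tau>, OF met \<xi> \<eta> \<tau>(1,3) \<W>]) auto
  then show ?thesis by blast
qed

theorem theorem1p1:
  fixes b :: "'a::metric_space" and d :: "(nat \<Rightarrow> 'a) set \<Rightarrow> (nat \<Rightarrow> 'a) set \<Rightarrow> real"
  assumes "gromov_hyperbolic TYPE('a)"
    and "visual_space b"
    and "visual_metric b d"
    and "cdim (bdry b) d < \<infinity>"
  shows "\<exists>(T :: nat \<Rightarrow> ('a \<times> real) set) dT (f :: 'a \<Rightarrow> nat \<Rightarrow> 'a \<times> real).
           (\<forall>i < the_enat (cdim (bdry b) d) + 1. metric_tree (T i) (dT i)) \<and>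
           (\<forall>x. \<forall>i < the_enat (cdim (bdry b) d) + 1. f x i \<in> T i) \<and>
           qi_embedding dist (prod_dist (the_enat (cdim (bdry b) d) + 1) dT) f"
proof -
  have "cdim_le (bdry b) d (the_enat (cdim (bdry b) d))"
    using assms(4) by (rule cdim_le_the_enat_cdim)
  then obtain \<rho> :: "'a \<Rightarrow> 'a \<Rightarrow> real" and N \<tau> \<eta> p \<omega> C
    where "visual_separated_families \<rho> N \<tau> \<eta> (the_enat (cdim (bdry b) d) + 1) p \<omega> C"
    using visual_separated_families_exist[OF assms(1-3)] by blast
  then show ?thesis
    by (rule visual_separated_families.qi_embedding_into_trees)
qed

end
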